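(* Let $(\lambda_n)_{n\in\mathbb N}$ be a sequence of positive integers such that $\lambda_{n+1}\ge3\lambda_n$ and $\lambda_n$ divides $\lambda_{n+1}$ for all $n\ge0$, let $(c_n)_{n\in\mathbb N}$ be complex numbers with $\sup_{n\in\mathbb N}|c_n|<1$, and let $\mu_c$ be the associated Riesz product $\mu_c=\prod_{n=0}^\infty\big(1+\mathrm{Re}\,c_ne^{2\pi i\lambda_nt}\big)$. Let $(f_n)_{n\in\mathbb N}$ be functions on $[0,1]$ for which there exist $C>0$ and $\epsilon>0$ such that $$\sup_{n\ge0}\omega(t,f_n)\le\frac{C}{|\log t|^{1/2+\epsilon}}\qquad(0<t<1).$$ Then for every $(a_n)_{n\in\mathbb N}\in\ell^2$, the series $$\sum_{n=0}^\infty a_n\big(f_n(\lambda_nx)-\mathbb E_{\mu_c}f_n(\lambda_n\cdot)\big)$$ converges for $\mu_c$-almost every $x$.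
   Context: $\mathbb N=\{0,1,2,\dots\}$, $\mathbb T=\mathbb R/\mathbb Z$. The Riesz product $\mu_c$ is the Borel probability measure on $\mathbb T$ that is the weak-* limit in $C(\mathbb T)^*$ of the measures with densities $\prod_{n=0}^{N}(1+\mathrm{Re}\,c_ne^{2\pi i\lambda_nt})$ with respect to Lebesgue measure as $N\to\infty$. $\mathbb E_{\mu_c}g=\int g\,d\mu_c$. In $f_n(\lambda_nx)$ the argument is taken modulo $1$. $\omega(t,f)=\sup\{|f(x)-f(y)|:|x-y|\le t\}$ is the (uniform) modulus of continuity. *)

theory Defs
  imports "HOL-Probability.Probability"
begin

text \<open>
  The circle \<open>\<real>/\<int>\<close> is represented by its fundamental domain \<open>{0..<1}\<close> with the Borel sets of
  the real line restricted to it; under \<open>x \<mapsto> x + \<int>\<close> these are exactly the Borel sets of the circle.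
  Continuous functions on the circle are the continuous functions on the real line with period 1.
\<close>

definition circle_lebesgue :: "real measure" where
  "circle_lebesgue = restrict_space lborel {0..<1}"

definition circle_continuous :: "(real \<Rightarrow> complex) \<Rightarrow> bool" where
  "circle_continuous g \<longleftrightarrow> continuous_on UNIV g \<and> (\<forall>t. g (t + 1) = g t)"

text \<open>
  The density below is nonnegative as soon as all coefficients have modulus at most 1,
  so that \<open>ennreal\<close> does not truncate.
\<close>

definition riesz_partial :: "(nat \<Rightarrow> nat) \<Rightarrow> (nat \<Rightarrow> complex) \<Rightarrow> nat \<Rightarrow> real measure" where
  "riesz_partial l c N =
     density circle_lebesgue
       (\<lambda>t. ennreal (\<Prod>n=0..N. 1 + Re (c n * exp (2 * of_real pi * \<i> * of_nat (l n) * of_real t))))"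

definition is_riesz_product :: "(nat \<Rightarrow> nat) \<Rightarrow> (nat \<Rightarrow> complex) \<Rightarrow> real measure \<Rightarrow> bool" where
  "is_riesz_product l c \<mu> \<longleftrightarrow>
     prob_space \<mu> \<and> sets \<mu> = sets circle_lebesgue \<and>
     (\<forall>g. circle_continuous g \<longrightarrow>
        (\<lambda>N. integral\<^sup>L (riesz_partial l c N) g) \<longlonglongrightarrow> integral\<^sup>L \<mu> g)"

text \<open>Extended-real valued, so that the supremum is meaningful for arbitrary \<open>f\<close>.\<close>

definition modulus_of_continuity ::
    "'a::metric_space set \<Rightarrow> real \<Rightarrow> ('a \<Rightarrow> 'b::metric_space) \<Rightarrow> ereal" where
  "modulus_of_continuity S t f =
     (SUP (x, y)\<in>{(x, y). x \<in> S \<and> y \<in> S \<and> dist x y \<le> t}. ereal (dist (f x) (f y)))"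

end

theory Submission
  imports Defs
begin

text \<open>
  Write \<open>T\<^sub>n x = frac (l\<^sub>n x)\<close> and let \<open>F\<^sub>n\<close> be the \<open>\<sigma>\<close>-algebra generated by \<open>T\<^sub>n\<close>. Since \<open>l\<^sub>n\<close> divides \<open>l\<^sub>n\<^sub>+\<^sub>1\<close>, the
  map \<open>T\<^sub>n\<^sub>+\<^sub>1\<close> is a function of \<open>T\<^sub>n\<close>, so the \<open>\<sigma>\<close>-algebras decrease, and \<open>f\<^sub>n (T\<^sub>n x)\<close> is measurable with
  respect to \<open>F\<^sub>n\<close>. The theorem follows from two facts about \<open>X\<^sub>m = f\<^sub>m \<circ> T\<^sub>m - E (f\<^sub>m \<circ> T\<^sub>m)\<close>.

  The first is analytic: the modulus of \<open>E[X\<^sub>m | F\<^sub>m\<^sub>+\<^sub>j]\<close> is at most a constant times \<open>(j + 1) powr -(1/2 + \<epsilon>)\<close>, uniformly in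
  \<open>m\<close> and in the point. Under a Riesz product, passing from \<open>F\<^sub>n\<close> to \<open>F\<^sub>n\<^sub>+\<^sub>1\<close> amounts to applying a transfer
  operator: the point \<open>w = T\<^sub>n\<^sub>+\<^sub>1 x\<close> has the \<open>q = l\<^sub>n\<^sub>+\<^sub>1 / l\<^sub>n\<close> preimages \<open>(w + i) / q\<close>, and each of them is weighted by
  the \<open>n\<close>-th factor of the product, divided by \<open>q\<close> (lemma \<open>transfer_tower\<close>). For \<open>q \<ge> 3\<close> this operator
  contracts Lipschitz constants on \<open>[0,1)\<close> by the factor \<open>23/25\<close>, and it does so up to an additive error that it does not
  amplify (\<open>transfer_contraction\<close>). A function with modulus of continuity \<open>\<omega>\<close> is Lipschitz with constant
  \<open>\<omega>(\<eta>)/\<eta>\<close> up to the error \<open>\<omega>(\<eta>)\<close>; with \<open>\<eta> = (23/25)^(j+1)\<close> the oscillation of its \<open>j\<close>-th iterate is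
  of order \<open>\<omega>((23/25)^(j+1))\<close>, and the logarithmic modulus turns this into the stated power of \<open>j + 1\<close>.
  Working on the interval rather than on the circle makes a jump of \<open>f\<^sub>n\<close> at the base point harmless,
  because \<open>[0,1)\<close> is cut into the branches \<open>[i/q, (i+1)/q)\<close>.

  The second is probabilistic (\<open>AE_summable_reverse_martingale\<close>): such a decay of conditional expectations
  along any decreasing filtration implies that \<open>\<Sum> a\<^sub>m X\<^sub>m\<close> converges almost everywhere for every
  square summable \<open>a\<close>. Expand \<open>X\<^sub>m = \<Sum>\<^sub>j D\<^sub>m\<^sub>j\<close> with \<open>D\<^sub>m\<^sub>j = E[X\<^sub>m | F\<^sub>m\<^sub>+\<^sub>j] - E[X\<^sub>m | F\<^sub>m\<^sub>+\<^sub>j\<^sub>+\<^sub>1]\<close>. For fixed \<open>j\<close> the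
  \<open>a\<^sub>m D\<^sub>m\<^sub>j\<close> are reverse martingale differences, so Doob's inequality bounds the maximal function of their
  partial sums. Summing the bounds over \<open>j\<close> by the Cauchy-Schwarz inequality with weights
  \<open>(j + 1) powr (1 + \<epsilon>)\<close> leaves \<open>\<Sum>\<^sub>j (j + 1) powr (1 + \<epsilon>) \<parallel>D\<^sub>m\<^sub>j\<parallel>\<^sup>2\<close>. By orthogonality \<open>\<parallel>D\<^sub>m\<^sub>j\<parallel>\<^sup>2\<close> is the decrease
  of \<open>\<parallel>E[X\<^sub>m | F\<^sub>m\<^sub>+\<^sub>j]\<parallel>\<^sup>2 = O((j + 1) powr -(1 + 2 \<epsilon>))\<close>, so Abel summation makes the sum converge; the exponent
  \<open>1/2\<close> is exactly what this argument consumes.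
\<close>

section \<open>Doob inequality for reverse martingales\<close>

text \<open>
  The pathwise form of Doob's inequality: when \<open>Max (s ` {..k})\<close> does not change, neither side of the
  half-square estimate inside the proof changes, and when it does, its new value is \<open>s (Suc k)\<close>. For a
  martingale \<open>s\<close> the subtracted sum has integral zero, which leaves the \<open>L\<^sup>2\<close> bound with constant \<open>4\<close>.
\<close>

lemma running_max_square_le:
  fixes s :: "nat \<Rightarrow> real"
  assumes "s 0 = 0"
  shows "(Max (s ` {..n}))\<^sup>2 \<le>
    4 * (s n)\<^sup>2 - 4 * (\<Sum>k<n. Max (s ` {..k}) * (s (Suc k) - s k))"
proof -
  define S where "S k = Max (s ` {..k})" for k
  have S_Suc: "S (Suc k) = max (s (Suc k)) (S k)" for k
    by (simp add: S_def atMost_Suc)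
  have S_ge: "s k \<le> S k" for k
    by (simp add: S_def)
  have key: "(S n)\<^sup>2 / 2 \<le> S n * s n - (\<Sum>k<n. S k * (s (Suc k) - s k))"
  proof (induction n)
    case 0
    show ?case using assms by (simp add: S_def)
  next
    case (Suc n)
    have "(S (Suc n))\<^sup>2 / 2 - (S n)\<^sup>2 / 2 \<le> (S (Suc n) - S n) * s (Suc n)"
    proof (cases "s (Suc n) \<le> S n")
      case True
      then show ?thesis by (simp add: S_Suc max_def)
    next
      case False
      then have "S (Suc n) = s (Suc n)" by (simp add: S_Suc)
      moreover have "0 \<le> (s (Suc n) - S n)\<^sup>2" by simp
      ultimately show ?thesis
        by (simp add: power2_eq_square algebra_simps)
    qed
    with Suc show ?case by (simp add: algebra_simps)
  qed
  moreover have "S n * s n \<le> (S n)\<^sup>2 / 4 + (s n)\<^sup>2"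
    using zero_le_power2[of "S n / 2 - s n"] by (simp add: power2_eq_square algebra_simps)
  ultimately show ?thesis
    unfolding S_def[symmetric] by (simp add: algebra_simps)
qed

locale reverse_filtration = prob_space M
  for M :: "'a measure" +
  fixes F :: "nat \<Rightarrow> 'a measure"
  assumes subalgebra_F: "subalgebra M (F n)"
    and decreasing_F: "sets (F (Suc n)) \<subseteq> sets (F n)"
begin

lemma sets_F_mono: "m \<le> n \<Longrightarrow> sets (F n) \<subseteq> sets (F m)"
  by (rule lift_Suc_antimono_le[of "\<lambda>n. sets (F n)"]) (use decreasing_F in auto)

lemma space_F: "space (F n) = space M"
  using subalgebra_F[of n] by (simp add: subalgebra_def)

lemma measurable_F_mono: "m \<le> n \<Longrightarrow> f \<in> borel_measurable (F n) \<Longrightarrow> f \<in> borel_measurable (F m)"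
  using sets_F_mono[of m n] space_F[of m] space_F[of n]
  by (auto simp: measurable_def)

lemma measurable_F_imp_M: "f \<in> borel_measurable (F n) \<Longrightarrow> f \<in> borel_measurable M"
  using measurable_from_subalg[OF subalgebra_F] .

lemma shifted: "reverse_filtration M (\<lambda>k. F (k + j))"
  using subalgebra_F decreasing_F by unfold_locales auto

lemma integrable_bounded:
  fixes f :: "'a \<Rightarrow> real"
  assumes "f \<in> borel_measurable M" "\<And>x. \<bar>f x\<bar> \<le> B"
  shows "integrable M f"
  by (rule integrable_const_bound[of _ B]) (use assms in auto)

lemma integrable_square:
  fixes f :: "'a \<Rightarrow> real"
  assumes "f \<in> borel_measurable M" "\<And>x. \<bar>f x\<bar> \<le> B"
  shows "integrable M (\<lambda>x. (f x)\<^sup>2)"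
proof (rule integrable_bounded[of _ "B\<^sup>2"])
  show "\<bar>(f x)\<^sup>2\<bar> \<le> B\<^sup>2" for x
    using power_mono[OF assms(2)[of x], of 2] by simp
qed (use assms(1) in measurable)

text \<open>
  Orthogonality of martingale increments. The vanishing of the integrals of \<open>d\<close> over the sets of \<open>F n\<close> says
  that its conditional expectation is zero, and this extends from indicators to bounded functions.
\<close>

lemma integral_mult_eq_0:
  fixes d g :: "'a \<Rightarrow> real"
  assumes d: "d \<in> borel_measurable M" "\<And>x. \<bar>d x\<bar> \<le> B"
    and g: "g \<in> borel_measurable (F n)" "\<And>x. \<bar>g x\<bar> \<le> C"
    and mean: "\<And>A. A \<in> sets (F n) \<Longrightarrow> (LINT x:A|M. d x) = 0"
  shows "(LINT x|M. g x * d x) = 0"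
proof -
  interpret finite_measure_subalgebra M "F n"
    by (intro finite_measure_subalgebra.intro finite_measure_subalgebra_axioms.intro
        finite_measure_axioms subalgebra_F)
  have gM: "g \<in> borel_measurable M" using g(1) by (rule measurable_F_imp_M)
  have "AE x in M. real_cond_exp M (F n) d x = (\<lambda>_. 0) x"
    by (rule real_cond_exp_charact) (use mean integrable_bounded[OF d] in \<open>auto simp: set_lebesgue_integral_def\<close>)
  then have ae: "AE x in M. g x * real_cond_exp M (F n) d x = 0" by auto
  have "integrable M (\<lambda>x. g x * d x)"
  proof (rule integrable_bounded[of _ "C * B"])
    show "\<bar>g x * d x\<bar> \<le> C * B" for x
      unfolding abs_mult using g(2)[of x] d(2)[of x] by (intro mult_mono) auto
  qed (use gM d(1) in measurable)
  from real_cond_exp_intg(2)[OF this g(1) d(1)] show ?thesis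
    using integral_cong_AE[OF _ _ ae] gM by simp
qed

text \<open>
  Along a decreasing filtration the tails \<open>\<Sum>k=n-i..<n. d k\<close>, read with increasing \<open>i\<close>, form an ordinary martingale:
  the increment \<open>d (n - Suc i)\<close> has mean zero over \<open>F (n - i)\<close>, where all the earlier tails live. The last two
  conclusions provide the integrability that the use of the first one needs.
\<close>

lemma tail_sum_maximal:
  fixes d :: "nat \<Rightarrow> 'a \<Rightarrow> real" and B :: "nat \<Rightarrow> real"
  assumes d: "\<And>k. d k \<in> borel_measurable (F k)" "\<And>k x. \<bar>d k x\<bar> \<le> B k"
    and mean: "\<And>k A. A \<in> sets (F (Suc k)) \<Longrightarrow> (LINT x:A|M. d k x) = 0"
  shows "(LINT x|M. (Max ((\<lambda>i. \<Sum>k=n-i..<n. d k x) ` {..n}))\<^sup>2)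
      \<le> 4 * (LINT x|M. (\<Sum>k<n. d k x)\<^sup>2)" (is "?L \<le> _")
    and "(LINT x|M. (\<Sum>k<n. d k x)\<^sup>2) = (\<Sum>k<n. LINT x|M. (d k x)\<^sup>2)"
    and "(\<lambda>x. Max ((\<lambda>i. \<Sum>k=n-i..<n. d k x) ` {..n})) \<in> borel_measurable M"
    and "\<And>x. \<bar>Max ((\<lambda>i. \<Sum>k=n-i..<n. d k x) ` {..n})\<bar> \<le> (\<Sum>k<n. B k)"
proof -
  have B0: "0 \<le> B k" for k using d(2)[of k undefined] by linarith
  have dM[measurable]: "d k \<in> borel_measurable M" for k using d(1) by (rule measurable_F_imp_M)
  define s where "s i x = (\<Sum>k=n-i..<n. d k x)" for i x
  define S where "S i x = Max ((\<lambda>j. s j x) ` {..i})" for i x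
  have sF: "s i \<in> borel_measurable (F (n - i'))" if "i \<le> i'" for i i'
    unfolding s_def using that by (intro borel_measurable_sum measurable_F_mono[OF _ d(1)]) auto
  have SF: "S i \<in> borel_measurable (F (n - i))" for i
    unfolding S_def by (intro borel_measurable_Max sF) auto
  have SM[measurable]: "S i \<in> borel_measurable M" for i
    using SF by (rule measurable_F_imp_M)
  have sM[measurable]: "s i \<in> borel_measurable M" for i
    using sF[of i i] by (intro measurable_F_imp_M) auto
  have s_bd: "\<bar>s i x\<bar> \<le> (\<Sum>k<n. B k)" for i x
  proof -
    have "\<bar>s i x\<bar> \<le> (\<Sum>k=n-i..<n. B k)"
      unfolding s_def by (rule order.trans[OF sum_abs]) (intro sum_mono d)
    also have "\<dots> \<le> (\<Sum>k<n. B k)"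
      using B0 by (intro sum_mono2) auto
    finally show ?thesis .
  qed
  have S_bd: "\<bar>S i x\<bar> \<le> (\<Sum>k<n. B k)" for i x
  proof -
    have "S i x \<in> (\<lambda>j. s j x) ` {..i}" unfolding S_def by (intro Max_in) auto
    then show ?thesis using s_bd by auto
  qed
  have s_Suc: "s (Suc i) x - s i x = d (n - Suc i) x" if "i < n" for i x
  proof -
    have "{n - Suc i..<n} = insert (n - Suc i) {n - i..<n}" using that by auto
    then show ?thesis using that by (simp add: s_def)
  qed
  have orth: "(LINT x|M. S i x * (s (Suc i) x - s i x)) = 0" if "i < n" for i
    unfolding s_Suc[OF that]
  proof (rule integral_mult_eq_0[OF dM d(2) SF S_bd])
    fix A assume "A \<in> sets (F (n - i))"
    then show "(LINT x:A|M. d (n - Suc i) x) = 0"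
      using mean[of A "n - Suc i"] that by (simp add: Suc_diff_Suc)
  qed
  have int_inc: "integrable M (\<lambda>x. S i x * (s (Suc i) x - s i x))" for i
  proof (rule integrable_bounded[of _ "(\<Sum>k<n. B k) * ((\<Sum>k<n. B k) + (\<Sum>k<n. B k))"])
    show "\<bar>S i x * (s (Suc i) x - s i x)\<bar> \<le> (\<Sum>k<n. B k) * ((\<Sum>k<n. B k) + (\<Sum>k<n. B k))" for x
      unfolding abs_mult using S_bd[of i x] s_bd[of i x] s_bd[of "Suc i" x]
      by (intro mult_mono) (auto intro!: sum_nonneg B0)
  qed measurable
  have int_S: "integrable M (\<lambda>x. (S i x)\<^sup>2)" and int_s: "integrable M (\<lambda>x. (s i x)\<^sup>2)" for i
    using integrable_square[OF SM S_bd] integrable_square[OF sM s_bd] by auto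
  have s_n: "s n x = (\<Sum>k<n. d k x)" for x
    by (simp add: s_def lessThan_atLeast0)
  have "(LINT x|M. (S n x)\<^sup>2) \<le>
     (LINT x|M. 4 * (s n x)\<^sup>2 - 4 * (\<Sum>k<n. S k x * (s (Suc k) x - s k x)))"
    using int_S int_s int_inc
    by (intro integral_mono) (auto simp: S_def intro!: running_max_square_le, simp add: s_def)
  also have "\<dots> = 4 * (LINT x|M. (s n x)\<^sup>2)"
    using int_s int_inc orth by simp
  finally show "?L \<le> 4 * (LINT x|M. (\<Sum>k<n. d k x)\<^sup>2)"
    unfolding s_n unfolding S_def s_def .
  show "(\<lambda>x. Max ((\<lambda>i. \<Sum>k=n-i..<n. d k x) ` {..n})) \<in> borel_measurable M"
    using SM[of n] unfolding S_def s_def by measurable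
  show "\<bar>Max ((\<lambda>i. \<Sum>k=n-i..<n. d k x) ` {..n})\<bar> \<le> (\<Sum>k<n. B k)" for x
    using S_bd[of n x] unfolding S_def s_def .
  have int_d: "integrable M (\<lambda>x. (d k x)\<^sup>2)" for k
    using integrable_square[OF dM d(2)] .
  have "(LINT x|M. (s i x)\<^sup>2) = (\<Sum>k=n-i..<n. LINT x|M. (d k x)\<^sup>2)" if "i \<le> n" for i
    using that
  proof (induction i)
    case 0
    then show ?case by (simp add: s_def)
  next
    case (Suc i)
    let ?d = "d (n - Suc i)"
    have bd: "\<bar>2 * s i x * ?d x\<bar> \<le> 2 * (\<Sum>k<n. B k) * B (n - Suc i)" for x
      unfolding abs_mult using s_bd[of i x] d(2)[of "n - Suc i" x]
      by (intro mult_mono) (auto intro!: sum_nonneg B0)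
    have "(LINT x|M. (s i x * ?d x)) = 0"
    proof (rule integral_mult_eq_0[OF dM d(2) sF[OF order.refl] s_bd])
      fix A assume "A \<in> sets (F (n - i))"
      then show "(LINT x:A|M. ?d x) = 0"
        using mean[of A "n - Suc i"] Suc.prems by (simp add: Suc_diff_Suc)
    qed
    moreover have "integrable M (\<lambda>x. 2 * s i x * ?d x)"
      by (rule integrable_bounded[OF _ bd]) measurable
    moreover have "(s (Suc i) x)\<^sup>2 = (s i x)\<^sup>2 + 2 * s i x * ?d x + (?d x)\<^sup>2" for x
      using s_Suc[of i x] Suc.prems by (simp add: algebra_simps power2_eq_square)
    moreover have "{n - Suc i..<n} = insert (n - Suc i) {n - i..<n}" using Suc.prems by auto
    ultimately show ?case
      using Suc int_s int_d by (simp add: mult.assoc)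
  qed
  from this[of n] show "(LINT x|M. (\<Sum>k<n. d k x)\<^sup>2) = (\<Sum>k<n. LINT x|M. (d k x)\<^sup>2)"
    by (simp add: s_n lessThan_atLeast0)
qed

text \<open>
  A partial sum is the total minus a tail. The one-sided tail bound, applied to \<open>d\<close> and to \<open>- d\<close>,
  controls the tails in absolute value.
\<close>

lemma partial_sum_maximal:
  fixes d :: "nat \<Rightarrow> 'a \<Rightarrow> real" and B :: "nat \<Rightarrow> real"
  assumes d: "\<And>k. d k \<in> borel_measurable (F k)" "\<And>k x. \<bar>d k x\<bar> \<le> B k"
    and mean: "\<And>k A. A \<in> sets (F (Suc k)) \<Longrightarrow> (LINT x:A|M. d k x) = 0"
  shows "(LINT x|M. Max ((\<lambda>N. (\<Sum>k<N. d k x)\<^sup>2) ` {..n}))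
      \<le> 18 * (\<Sum>k<n. LINT x|M. (d k x)\<^sup>2)"
proof -
  have dM[measurable]: "d k \<in> borel_measurable M" for k using d(1) by (rule measurable_F_imp_M)
  define s where "s d i x = (\<Sum>k=n-i..<n. d k x)" for d :: "nat \<Rightarrow> 'a \<Rightarrow> real" and i x
  define S where "S d x = Max ((\<lambda>i. s d i x) ` {..n})" for d :: "nat \<Rightarrow> 'a \<Rightarrow> real" and x
  define T where "T x = (\<Sum>k<n. d k x)" for x
  define d' where "d' k x = - d k x" for k x
  have mean': "(LINT x:A|M. d' k x) = 0" if "A \<in> sets (F (Suc k))" for k A
    using mean[OF that] by (simp add: d'_def set_lebesgue_integral_def)
  have d'F: "d' k \<in> borel_measurable (F k)" for k
    unfolding d'_def using d(1) by measurable
  have d'B: "\<bar>d' k x\<bar> \<le> B k" for k x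
    using d(2) by (simp add: d'_def)
  note D = tail_sum_maximal[OF d mean, where n = n, folded s_def, folded S_def]
  note D' = tail_sum_maximal[OF d'F d'B mean', where n = n, folded s_def, folded S_def]
  have T_bd: "\<bar>T x\<bar> \<le> (\<Sum>k<n. B k)" for x
    unfolding T_def by (rule order.trans[OF sum_abs]) (intro sum_mono d)
  have int: "integrable M (\<lambda>x. (S d x)\<^sup>2)" "integrable M (\<lambda>x. (S d' x)\<^sup>2)" "integrable M (\<lambda>x. (T x)\<^sup>2)"
  proof -
    show "integrable M (\<lambda>x. (S d x)\<^sup>2)" by (rule integrable_square[OF D(3,4)])
    show "integrable M (\<lambda>x. (S d' x)\<^sup>2)" by (rule integrable_square[OF D'(3,4)])
    show "integrable M (\<lambda>x. (T x)\<^sup>2)" by (rule integrable_square[OF _ T_bd]) (simp add: T_def)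
  qed
  have ptw: "Max ((\<lambda>N. (\<Sum>k<N. d k x)\<^sup>2) ` {..n}) \<le> 2 * (T x)\<^sup>2 + 2 * (S d x)\<^sup>2 + 2 * (S d' x)\<^sup>2" for x
  proof (rule Max.boundedI)
    fix y assume "y \<in> (\<lambda>N. (\<Sum>k<N. d k x)\<^sup>2) ` {..n}"
    then obtain N where N: "N \<le> n" "y = (\<Sum>k<N. d k x)\<^sup>2" by auto
    have "(\<Sum>k<N. d k x) + s d (n - N) x = T x"
      using N(1) by (simp add: s_def T_def sum.atLeastLessThan_concat lessThan_atLeast0)
    then have "(\<Sum>k<N. d k x) = T x - s d (n - N) x" by linarith
    with N have y: "y = (T x - s d (n - N) x)\<^sup>2" by simp
    have "s d (n - N) x \<le> S d x" unfolding S_def by (intro Max_ge) auto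
    moreover have "s d' (n - N) x \<le> S d' x" unfolding S_def by (intro Max_ge) auto
    moreover have "s d' (n - N) x = - s d (n - N) x" by (simp add: s_def d'_def sum_negf)
    ultimately have "\<bar>s d (n - N) x\<bar> \<le> \<bar>S d x\<bar> \<or> \<bar>s d (n - N) x\<bar> \<le> \<bar>S d' x\<bar>" by linarith
    then have "(s d (n - N) x)\<^sup>2 \<le> (S d x)\<^sup>2 + (S d' x)\<^sup>2"
      unfolding abs_le_square_iff by (smt (verit) zero_le_power2)
    moreover have "(T x - s d (n - N) x)\<^sup>2 \<le> 2 * (T x)\<^sup>2 + 2 * (s d (n - N) x)\<^sup>2"
      using zero_le_power2[of "T x + s d (n - N) x"] by (simp add: power2_eq_square algebra_simps)
    ultimately show "y \<le> 2 * (T x)\<^sup>2 + 2 * (S d x)\<^sup>2 + 2 * (S d' x)\<^sup>2" unfolding y by linarith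
  qed auto
  have "(LINT x|M. Max ((\<lambda>N. (\<Sum>k<N. d k x)\<^sup>2) ` {..n})) \<le>
      (LINT x|M. 2 * (T x)\<^sup>2 + 2 * (S d x)\<^sup>2 + 2 * (S d' x)\<^sup>2)"
  proof (rule integral_mono')
    show "0 \<le> 2 * (T x)\<^sup>2 + 2 * (S d x)\<^sup>2 + 2 * (S d' x)\<^sup>2" for x by simp
  qed (use int ptw in auto)
  also have "\<dots> = 2 * (LINT x|M. (T x)\<^sup>2) + 2 * (LINT x|M. (S d x)\<^sup>2) + 2 * (LINT x|M. (S d' x)\<^sup>2)"
    using int by simp
  also have "(LINT x|M. (S d x)\<^sup>2) \<le> 4 * (LINT x|M. (T x)\<^sup>2)"
    using D(1) by (simp add: T_def)
  also have "(LINT x|M. (S d' x)\<^sup>2) \<le> 4 * (LINT x|M. (T x)\<^sup>2)"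
    using D'(1) by (simp add: T_def d'_def sum_negf)
  finally show ?thesis using D(2) unfolding T_def by simp
qed

end

section \<open>Series with decaying conditional expectations\<close>

lemma summable_inverse_powr:
  assumes "\<epsilon> > 0"
  shows "summable (\<lambda>j. 1 / real (Suc j) powr (1 + \<epsilon>))"
proof -
  have "summable (\<lambda>j. real (Suc j) powr - (1 + \<epsilon>))"
    using assms by (subst summable_Suc_iff) (simp add: summable_real_powr_iff)
  then show ?thesis unfolding powr_minus_divide .
qed

text \<open>
  Abel summation moves the differences onto the weights, where the mean value theorem gives
  \<open>(j + 2) powr (1 + \<epsilon>) - (j + 1) powr (1 + \<epsilon>) \<le> (1 + \<epsilon>) (j + 2) powr \<epsilon>\<close>. Against the decay of \<open>y\<close>
  this leaves the convergent series of the \<open>(j + 1) powr -(1 + \<epsilon>)\<close>.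
\<close>

lemma weighted_telescoping_le:
  fixes y :: "nat \<Rightarrow> real"
  assumes y: "\<And>j. 0 \<le> y j" "\<And>j. y j \<le> (K / real (Suc j) powr (1/2 + \<epsilon>))\<^sup>2" and \<epsilon>: "\<epsilon> > 0"
  shows "(\<Sum>j<J. real (Suc j) powr (1 + \<epsilon>) * (y j - y (Suc j)))
    \<le> K\<^sup>2 * (1 + (1 + \<epsilon>) * (\<Sum>j<J. 1 / real (Suc j) powr (1 + \<epsilon>)))"
proof -
  define w where "w j = real (Suc j) powr (1 + \<epsilon>)" for j
  have abel: "(\<Sum>j<J. w j * (y j - y (Suc j))) + w J * y J = w 0 * y 0 + (\<Sum>j<J. (w (Suc j) - w j) * y (Suc j))"
    by (induction J) (simp_all add: algebra_simps)
  have step: "(w (Suc j) - w j) * y (Suc j) \<le> K\<^sup>2 * (1 + \<epsilon>) * (1 / real (Suc j) powr (1 + \<epsilon>))" for j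
  proof -
    define t where "t = real (Suc (Suc j))"
    have t: "t \<ge> 2" "t - 1 = real (Suc j)" by (auto simp: t_def)
    have "\<exists>z. t - 1 < z \<and> z < t \<and> t powr (1 + \<epsilon>) - (t - 1) powr (1 + \<epsilon>) = (t - (t - 1)) * ((1 + \<epsilon>) * z powr \<epsilon>)"
    proof (rule MVT2)
      fix x assume "t - 1 \<le> x" "x \<le> t"
      then have "x > 0" using t by linarith
      then show "((\<lambda>x. x powr (1 + \<epsilon>)) has_real_derivative (1 + \<epsilon>) * x powr \<epsilon>) (at x)"
        by (auto intro!: derivative_eq_intros)
    qed simp
    then obtain z where z: "t - 1 < z" "z < t" "t powr (1 + \<epsilon>) - (t - 1) powr (1 + \<epsilon>) = (1 + \<epsilon>) * z powr \<epsilon>"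
      by auto
    have "w (Suc j) - w j = (1 + \<epsilon>) * z powr \<epsilon>"
      using z(3) t(2) by (simp add: w_def t_def)
    also have "\<dots> \<le> (1 + \<epsilon>) * t powr \<epsilon>"
      using z t \<epsilon> by (intro mult_left_mono powr_mono2) auto
    finally have "(w (Suc j) - w j) * y (Suc j) \<le> (1 + \<epsilon>) * t powr \<epsilon> * y (Suc j)"
      using y(1) by (intro mult_right_mono) auto
    also have "\<dots> \<le> (1 + \<epsilon>) * t powr \<epsilon> * (K / t powr (1/2 + \<epsilon>))\<^sup>2"
      using y(2)[of "Suc j"] \<epsilon> by (intro mult_left_mono) (auto simp: t_def)
    also have "(K / t powr (1/2 + \<epsilon>))\<^sup>2 = K\<^sup>2 / t powr (1 + 2 * \<epsilon>)"
    proof -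
      have "(t powr (1/2 + \<epsilon>))\<^sup>2 = t powr (1 + 2 * \<epsilon>)"
        by (simp add: power2_eq_square powr_add[symmetric] algebra_simps)
      then show ?thesis by (simp add: power_divide)
    qed
    also have "(1 + \<epsilon>) * t powr \<epsilon> * (K\<^sup>2 / t powr (1 + 2 * \<epsilon>)) = K\<^sup>2 * (1 + \<epsilon>) * (1 / t powr (1 + \<epsilon>))"
    proof -
      have "t powr (1 + 2 * \<epsilon>) = t powr \<epsilon> * t powr (1 + \<epsilon>)"
        by (simp add: powr_add[symmetric] algebra_simps)
      then show ?thesis using t by simp
    qed
    also have "\<dots> \<le> K\<^sup>2 * (1 + \<epsilon>) * (1 / real (Suc j) powr (1 + \<epsilon>))"
      using \<epsilon> t by (intro mult_left_mono divide_left_mono powr_mono2 mult_nonneg_nonneg) (auto simp: t_def)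
    finally show ?thesis .
  qed
  have "(\<Sum>j<J. w j * (y j - y (Suc j))) \<le> w 0 * y 0 + (\<Sum>j<J. (w (Suc j) - w j) * y (Suc j))"
  proof -
    have "0 \<le> w J * y J" using y(1) by (simp add: w_def)
    then show ?thesis using abel by linarith
  qed
  also have "\<dots> \<le> K\<^sup>2 + (\<Sum>j<J. K\<^sup>2 * (1 + \<epsilon>) * (1 / real (Suc j) powr (1 + \<epsilon>)))"
    using y(2)[of 0] by (intro add_mono sum_mono step) (auto simp: w_def)
  also have "\<dots> = K\<^sup>2 * (1 + (1 + \<epsilon>) * (\<Sum>j<J. 1 / real (Suc j) powr (1 + \<epsilon>)))"
    by (simp only: sum_distrib_left[symmetric]) (simp add: algebra_simps)
  finally show ?thesis unfolding w_def .
qed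

lemma weighted_Cauchy_Schwarz:
  fixes z w :: "nat \<Rightarrow> real"
  assumes "\<And>j. w j > 0"
  shows "(\<Sum>j<J. z j)\<^sup>2 \<le> (\<Sum>j<J. 1 / w j) * (\<Sum>j<J. w j * (z j)\<^sup>2)"
proof -
  have "(\<Sum>j<J. z j)\<^sup>2 = (\<Sum>j<J. (1 / sqrt (w j)) * (sqrt (w j) * z j))\<^sup>2"
    using assms by (simp add: less_imp_neq[symmetric])
  also have "\<dots> \<le> (\<Sum>j<J. (1 / sqrt (w j))\<^sup>2) * (\<Sum>j<J. (sqrt (w j) * z j)\<^sup>2)"
    by (rule Cauchy_Schwarz_ineq_sum)
  also have "\<dots> = (\<Sum>j<J. 1 / w j) * (\<Sum>j<J. w j * (z j)\<^sup>2)"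
    using assms by (simp add: power_divide power_mult_distrib less_imp_le)
  finally show ?thesis .
qed

text \<open>
  Applied from the index \<open>p\<close> on, the maximal inequality bounds the integral of the supremum of the squared
  partial sums by the tail of \<open>\<Sum> b\<close>. Hence the infimum over \<open>p\<close> of these suprema vanishes almost everywhere,
  which is the Cauchy criterion.
\<close>

lemma (in prob_space) AE_summable_if_maximal_inequality:
  fixes Z :: "nat \<Rightarrow> 'a \<Rightarrow> real"
  assumes Z[measurable]: "\<And>m. Z m \<in> borel_measurable M" and bd: "\<And>m x. \<bar>Z m x\<bar> \<le> B m"
    and b: "summable b" "\<And>m. 0 \<le> b m" and V: "0 \<le> V"
    and maximal: "\<And>p n. (LINT x|M. Max ((\<lambda>N. (\<Sum>m<N. Z (p + m) x)\<^sup>2) ` {..n})) \<le> V * (\<Sum>m<n. b (p + m))"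
  shows "AE x in M. summable (\<lambda>m. Z m x)"
proof -
  define G where "G p n x = Max ((\<lambda>N. (\<Sum>m<N. Z (p + m) x)\<^sup>2) ` {..n})" for p n x
  have G_ge: "(\<Sum>m<N. Z (p + m) x)\<^sup>2 \<le> G p n x" if "N \<le> n" for p n x N
    unfolding G_def using that by (intro Max_ge) auto
  have G0: "0 \<le> G p n x" for p n x
    using G_ge[of 0 n p x] by simp
  have G_mono: "G p n x \<le> G p n' x" if "n \<le> n'" for p n n' x
    unfolding G_def using that by (intro Max_mono) auto
  have Gm[measurable]: "G p n \<in> borel_measurable M" for p n
    unfolding G_def by measurable
  have G_bd: "G p n x \<le> (\<Sum>m<n. B (p + m))\<^sup>2" for p n x
    unfolding G_def
  proof (rule Max.boundedI)
    fix y assume "y \<in> (\<lambda>N. (\<Sum>m<N. Z (p + m) x)\<^sup>2) ` {..n}"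
    then obtain N where N: "N \<le> n" "y = (\<Sum>m<N. Z (p + m) x)\<^sup>2" by auto
    have B0: "0 \<le> B m" for m using bd[of m x] by linarith
    have "\<bar>\<Sum>m<N. Z (p + m) x\<bar> \<le> (\<Sum>m<N. B (p + m))"
      by (rule order.trans[OF sum_abs]) (intro sum_mono bd)
    also have "\<dots> \<le> (\<Sum>m<n. B (p + m))" using N(1) B0 by (intro sum_mono2) auto
    finally show "y \<le> (\<Sum>m<n. B (p + m))\<^sup>2" unfolding N(2)
      using power_mono[of "\<bar>\<Sum>m<N. Z (p + m) x\<bar>" "\<Sum>m<n. B (p + m)" 2] by simp
  qed auto
  have G_int: "integrable M (G p n)" for p n
    by (rule integrable_const_bound[of _ "(\<Sum>m<n. B (p + m))\<^sup>2"]) (use G0 G_bd in auto)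
  define H where "H p x = (SUP n. ennreal (G p n x))" for p x
  define \<tau> where "\<tau> p = (\<Sum>m. b (p + m))" for p
  have Hm[measurable]: "H p \<in> borel_measurable M" for p unfolding H_def by measurable
  have H_int: "(\<integral>\<^sup>+x. H p x \<partial>M) \<le> ennreal (V * \<tau> p)" for p
  proof -
    have "(\<integral>\<^sup>+x. H p x \<partial>M) = (SUP n. \<integral>\<^sup>+x. ennreal (G p n x) \<partial>M)"
      unfolding H_def by (rule nn_integral_monotone_convergence_SUP)
        (auto intro!: incseq_SucI le_funI ennreal_leI G_mono)
    also have "\<dots> \<le> ennreal (V * \<tau> p)"
    proof (rule SUP_least)
      fix n
      have "(\<integral>\<^sup>+x. ennreal (G p n x) \<partial>M) = ennreal (LINT x|M. G p n x)"
        using G_int G0 by (intro nn_integral_eq_integral) auto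
      also have "\<dots> \<le> ennreal (V * \<tau> p)"
      proof (rule ennreal_leI)
        have "(\<Sum>m<n. b (p + m)) \<le> \<tau> p"
          unfolding \<tau>_def using b summable_ignore_initial_segment[OF b(1), of p]
          by (intro sum_le_suminf) (auto simp: add.commute)
        then show "(LINT x|M. G p n x) \<le> V * \<tau> p"
          using maximal[of p n] V unfolding G_def by (meson mult_left_mono order.trans)
      qed
      finally show "(\<integral>\<^sup>+x. ennreal (G p n x) \<partial>M) \<le> ennreal (V * \<tau> p)" .
    qed
    finally show ?thesis .
  qed
  have "\<tau> p = suminf b - (\<Sum>m<p. b m)" for p
    unfolding \<tau>_def suminf_split_initial_segment[OF b(1), of p] by (simp add: add.commute)
  then have "\<tau> = (\<lambda>p. suminf b - (\<Sum>m<p. b m))" by auto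
  then have "\<tau> \<longlonglongrightarrow> 0"
    using tendsto_diff[OF tendsto_const summable_LIMSEQ[OF b(1)], of "suminf b"] by simp
  then have lim: "(\<lambda>p. ennreal (V * \<tau> p)) \<longlonglongrightarrow> ennreal (V * 0)"
    by (intro tendsto_ennrealI tendsto_mult tendsto_const)
  have "(\<integral>\<^sup>+x. (INF p. H p x) \<partial>M) \<le> ennreal (V * \<tau> p)" for p
    by (rule order.trans[OF nn_integral_mono H_int]) (auto intro: INF_lower)
  then have "(\<integral>\<^sup>+x. (INF p. H p x) \<partial>M) \<le> ennreal (V * 0)"
    by (intro LIMSEQ_le_const[OF lim]) auto
  then have "(\<integral>\<^sup>+x. (INF p. H p x) \<partial>M) = 0" by simp
  then have "AE x in M. (INF p. H p x) = 0"
    by (subst (asm) nn_integral_0_iff_AE) auto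
  then show ?thesis
  proof eventually_elim
    case (elim x)
    show ?case unfolding summable_Cauchy
    proof (intro allI impI)
      fix e :: real assume e: "e > 0"
      then have "(INF p. H p x) < ennreal ((e/2)\<^sup>2)" using elim by simp
      then obtain p where p: "H p x < ennreal ((e/2)\<^sup>2)" by (auto simp: INF_less_iff)
      have small: "\<bar>sum (\<lambda>m. Z m x) {p..<n}\<bar> < e/2" if "p \<le> n" for n
      proof -
        have "ennreal (G p (n - p) x) \<le> H p x" unfolding H_def by (rule SUP_upper) simp
        with p have "ennreal (G p (n - p) x) < ennreal ((e/2)\<^sup>2)" by order
        then have "G p (n - p) x < (e/2)\<^sup>2" using G0 by (simp add: ennreal_less_iff)
        moreover have "(\<Sum>m<n - p. Z (p + m) x)\<^sup>2 \<le> G p (n - p) x" by (rule G_ge) simp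
        moreover have "(\<Sum>m<n - p. Z (p + m) x) = sum (\<lambda>m. Z m x) {p..<n}"
          using that sum.shift_bounds_nat_ivl[of "\<lambda>m. Z m x" 0 p "n - p"]
          by (simp add: lessThan_atLeast0 add.commute)
        ultimately have "\<bar>sum (\<lambda>m. Z m x) {p..<n}\<bar>\<^sup>2 < (e/2)\<^sup>2" by simp
        then show ?thesis by (rule power2_less_imp_less) (use e in simp)
      qed
      show "\<exists>N. \<forall>m\<ge>N. \<forall>n. norm (sum (\<lambda>m. Z m x) {m..<n}) < e"
      proof (intro exI[of _ p] allI impI)
        fix m n assume m: "m \<ge> p"
        show "norm (sum (\<lambda>m. Z m x) {m..<n}) < e"
        proof (cases "m \<le> n")
          case True
          then have "sum (\<lambda>m. Z m x) {p..<m} + sum (\<lambda>m. Z m x) {m..<n} = sum (\<lambda>m. Z m x) {p..<n}"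
            using m by (intro sum.atLeastLessThan_concat)
          moreover have "p \<le> n" using m True by simp
          ultimately show ?thesis
            using small[OF m] small[of n] unfolding real_norm_def by linarith
        next
          case False
          then show ?thesis using e by simp
        qed
      qed
    qed
  qed
qed

context reverse_filtration
begin

text \<open>
  Here \<open>Y m j\<close> is a version of the conditional expectation of \<open>Y m 0\<close> given \<open>F (m + j)\<close>. The constant depends
  only on \<open>K\<close> and \<open>\<epsilon>\<close>, so that the inequality may be applied to every shifted sequence.
\<close>

lemma maximal_inequality:
  fixes Y :: "nat \<Rightarrow> nat \<Rightarrow> 'a \<Rightarrow> real" and a :: "nat \<Rightarrow> real"
  assumes Y: "\<And>m j. Y m j \<in> borel_measurable (F (m + j))"
    and decay: "\<And>m j x. \<bar>Y m j x\<bar> \<le> K / real (Suc j) powr (1/2 + \<epsilon>)"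
    and tower: "\<And>m j A. A \<in> sets (F (Suc (m + j))) \<Longrightarrow> (LINT x:A|M. Y m j x) = (LINT x:A|M. Y m (Suc j) x)"
    and \<epsilon>: "\<epsilon> > 0"
  defines "W \<equiv> (\<Sum>j. 1 / real (Suc j) powr (1 + \<epsilon>))"
  shows "(LINT x|M. Max ((\<lambda>N. (\<Sum>m<N. a m * Y m 0 x)\<^sup>2) ` {..n}))
    \<le> 36 * W * K\<^sup>2 * (1 + (1 + \<epsilon>) * W) * (\<Sum>m<n. (a m)\<^sup>2)"
proof -
  define w where "w j = real (Suc j) powr (1 + \<epsilon>)" for j
  have w: "w j > 0" for j by (simp add: w_def)
  have w0: "0 \<le> w j" for j by (simp add: w_def)
  have summ: "summable (\<lambda>j. 1 / w j)"
    unfolding w_def by (rule summable_inverse_powr[OF \<epsilon>])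
  have W: "(\<Sum>j<J. 1 / w j) \<le> W" for J
    unfolding W_def w_def[symmetric] by (intro sum_le_suminf summ) (auto simp: w0)
  have W0: "0 \<le> W" using W[of 0] by simp
  define \<phi> where "\<phi> j = K / real (Suc j) powr (1/2 + \<epsilon>)" for j
  have decay: "\<bar>Y m j x\<bar> \<le> \<phi> j" for m j x using decay by (simp add: \<phi>_def)
  have \<phi>0: "0 \<le> \<phi> j" for j using decay[of 0 j undefined] by linarith
  have YM[measurable]: "Y m j \<in> borel_measurable M" for m j
    using Y by (rule measurable_F_imp_M)
  define D where "D m j x = Y m j x - Y m (Suc j) x" for m j x
  have DF: "D m j \<in> borel_measurable (F (m + j))" for m j
    unfolding D_def using Y[of m j] measurable_F_mono[OF _ Y[of m "Suc j"], of "m + j"]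
    by (intro borel_measurable_diff) auto
  have DM[measurable]: "D m j \<in> borel_measurable M" for m j using DF by (rule measurable_F_imp_M)
  have D_bd: "\<bar>D m j x\<bar> \<le> \<phi> j + \<phi> (Suc j)" for m j x
    using decay[of m j x] decay[of m "Suc j" x] by (simp add: D_def)
  have D_mean: "(LINT x:A|M. D m j x) = 0" if "A \<in> sets (F (Suc (m + j)))" for m j A
  proof -
    have "A \<in> sets M" using that subalgebra_F by (auto simp: subalgebra_def)
    then have "set_integrable M A (Y m j)" for m j
      unfolding set_integrable_def using integrable_bounded[OF YM decay]
      by (intro integrable_mult_indicator) auto
    then show ?thesis unfolding D_def using tower[OF that] by (simp add: set_integral_diff)
  qed
  define y where "y m j = (LINT x|M. (Y m j x)\<^sup>2)" for m j
  have y_bd: "0 \<le> y m j" "y m j \<le> (\<phi> j)\<^sup>2" for m j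
  proof -
    show "0 \<le> y m j" by (simp add: y_def)
    have "y m j \<le> (LINT x|M. (\<phi> j)\<^sup>2)"
      unfolding y_def
    proof (rule integral_mono)
      show "(Y m j x)\<^sup>2 \<le> (\<phi> j)\<^sup>2" for x
        using power_mono[OF decay[of m j x], of 2] by simp
    qed (use integrable_square[OF YM decay] in auto)
    then show "y m j \<le> (\<phi> j)\<^sup>2" by (simp add: prob_space)
  qed
  have D_energy: "(LINT x|M. (D m j x)\<^sup>2) = y m j - y m (Suc j)" for m j
  proof -
    have "(LINT x|M. Y m (Suc j) x * D m j x) = 0"
      using Y[of m "Suc j"] decay by (intro integral_mult_eq_0[OF DM D_bd _ _ D_mean]) auto
    moreover have "integrable M (\<lambda>x. Y m (Suc j) x * D m j x)"
    proof (rule integrable_bounded[of _ "\<phi> (Suc j) * (\<phi> j + \<phi> (Suc j))"])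
      show "\<bar>Y m (Suc j) x * D m j x\<bar> \<le> \<phi> (Suc j) * (\<phi> j + \<phi> (Suc j))" for x
        unfolding abs_mult using \<phi>0 by (intro mult_mono decay D_bd) auto
    qed measurable
    moreover have "(D m j x)\<^sup>2 = (Y m j x)\<^sup>2 - (Y m (Suc j) x)\<^sup>2 - 2 * (Y m (Suc j) x * D m j x)" for x
      by (simp add: D_def power2_eq_square algebra_simps)
    ultimately show ?thesis
      using integrable_square[OF YM decay] by (simp add: y_def)
  qed
  \<comment> \<open>For fixed \<open>j\<close>, the differences \<open>a k * D k j\<close> form a reverse martingale for the filtration shifted by \<open>j\<close>.\<close>
  define Mx where "Mx j x = Max ((\<lambda>N. (\<Sum>k<N. a k * D k j x)\<^sup>2) ` {..n})" for j x
  have Mx_int: "integrable M (Mx j)" for j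
  proof (rule integrable_bounded[of _ "(\<Sum>k<n. \<bar>a k\<bar> * (\<phi> j + \<phi> (Suc j)))\<^sup>2"])
    show "Mx j \<in> borel_measurable M" unfolding Mx_def by measurable
    fix x
    have "Mx j x \<in> (\<lambda>N. (\<Sum>k<N. a k * D k j x)\<^sup>2) ` {..n}" unfolding Mx_def by (intro Max_in) auto
    then obtain N where N: "N \<le> n" "Mx j x = (\<Sum>k<N. a k * D k j x)\<^sup>2" by auto
    have "\<bar>\<Sum>k<N. a k * D k j x\<bar> \<le> (\<Sum>k<N. \<bar>a k\<bar> * (\<phi> j + \<phi> (Suc j)))"
      by (rule order.trans[OF sum_abs]) (auto simp: abs_mult intro!: sum_mono mult_left_mono D_bd)
    also have "\<dots> \<le> (\<Sum>k<n. \<bar>a k\<bar> * (\<phi> j + \<phi> (Suc j)))"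
      using N(1) \<phi>0 by (intro sum_mono2) (auto intro!: mult_nonneg_nonneg add_nonneg_nonneg)
    finally show "\<bar>Mx j x\<bar> \<le> (\<Sum>k<n. \<bar>a k\<bar> * (\<phi> j + \<phi> (Suc j)))\<^sup>2"
      using power_mono[of "\<bar>\<Sum>k<N. a k * D k j x\<bar>" _ 2] by (simp add: N(2))
  qed
  have Mx_le: "(LINT x|M. Mx j x) \<le> 18 * (\<Sum>k<n. (a k)\<^sup>2 * (y k j - y k (Suc j)))" for j
  proof -
    interpret shift: reverse_filtration M "\<lambda>k. F (k + j)" by (rule shifted)
    have "(LINT x|M. Mx j x) \<le> 18 * (\<Sum>k<n. LINT x|M. (a k * D k j x)\<^sup>2)"
      unfolding Mx_def
    proof (rule shift.partial_sum_maximal)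
      show "(\<lambda>x. a k * D k j x) \<in> borel_measurable (F (k + j))" for k
        using DF by measurable
      show "\<bar>a k * D k j x\<bar> \<le> \<bar>a k\<bar> * (\<phi> j + \<phi> (Suc j))" for k x
        by (auto simp: abs_mult intro!: mult_left_mono D_bd)
      show "(LINT x:A|M. a k * D k j x) = 0" if "A \<in> sets (F (Suc k + j))" for k A
        using D_mean[of A k j] that by simp
    qed
    then show ?thesis by (simp add: power_mult_distrib D_energy)
  qed
  define C where "C = K\<^sup>2 * (1 + (1 + \<epsilon>) * W)"
  define V where "V = 36 * W * C"
  define r where "r J = (\<Sum>k<n. \<bar>a k\<bar>) * \<phi> J" for J
  \<comment> \<open>The expansion into differences is stopped at \<open>J\<close>; the remainder \<open>r J\<close> vanishes as \<open>J\<close> grows, for fixed \<open>n\<close>.\<close>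
  have trunc: "(LINT x|M. Max ((\<lambda>N. (\<Sum>m<N. a m * Y m 0 x)\<^sup>2) ` {..n}))
      \<le> V * (\<Sum>m<n. (a m)\<^sup>2) + 2 * (r J)\<^sup>2" for J
  proof -
    have ptw: "Max ((\<lambda>N. (\<Sum>m<N. a m * Y m 0 x)\<^sup>2) ` {..n}) \<le> 2 * W * (\<Sum>j<J. w j * Mx j x) + 2 * (r J)\<^sup>2" for x
    proof (rule Max.boundedI)
      fix v assume "v \<in> (\<lambda>N. (\<Sum>m<N. a m * Y m 0 x)\<^sup>2) ` {..n}"
      then obtain N where N: "N \<le> n" "v = (\<Sum>m<N. a m * Y m 0 x)\<^sup>2" by auto
      define z where "z j = (\<Sum>k<N. a k * D k j x)" for j
      define R where "R = (\<Sum>k<N. a k * Y k J x)"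
      have "Y k 0 x = (\<Sum>j<J. D k j x) + Y k J x" for k
        unfolding D_def by (induction J) auto
      then have "(\<Sum>m<N. a m * Y m 0 x) = (\<Sum>k<N. \<Sum>j<J. a k * D k j x) + R"
        by (simp add: R_def distrib_left sum.distrib sum_distrib_left)
      also have "(\<Sum>k<N. \<Sum>j<J. a k * D k j x) = (\<Sum>j<J. z j)"
        unfolding z_def by (rule sum.swap)
      finally have "v = ((\<Sum>j<J. z j) + R)\<^sup>2" using N by simp
      also have "\<dots> \<le> 2 * (\<Sum>j<J. z j)\<^sup>2 + 2 * R\<^sup>2"
        using zero_le_power2[of "(\<Sum>j<J. z j) - R"] by (simp add: power2_eq_square algebra_simps)
      also have "R\<^sup>2 \<le> (r J)\<^sup>2"
      proof -
        have "\<bar>R\<bar> \<le> (\<Sum>k<N. \<bar>a k\<bar> * \<phi> J)"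
          unfolding R_def by (rule order.trans[OF sum_abs]) (auto simp: abs_mult intro!: sum_mono mult_left_mono decay)
        also have "\<dots> \<le> (\<Sum>k<n. \<bar>a k\<bar> * \<phi> J)"
          using N(1) \<phi>0 by (intro sum_mono2) auto
        finally have "\<bar>R\<bar> \<le> r J" by (simp add: r_def sum_distrib_right)
        from power_mono[OF this, of 2] show ?thesis by simp
      qed
      also have "(\<Sum>j<J. z j)\<^sup>2 \<le> W * (\<Sum>j<J. w j * Mx j x)"
      proof -
        have Mxz: "(z j)\<^sup>2 \<le> Mx j x" for j unfolding Mx_def z_def using N(1) by (intro Max_ge) auto
        have "(\<Sum>j<J. z j)\<^sup>2 \<le> (\<Sum>j<J. 1 / w j) * (\<Sum>j<J. w j * (z j)\<^sup>2)"
          by (rule weighted_Cauchy_Schwarz[OF w])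
        also have "\<dots> \<le> W * (\<Sum>j<J. w j * Mx j x)"
          by (intro mult_mono W W0 sum_mono mult_left_mono Mxz sum_nonneg w0 mult_nonneg_nonneg) auto
        finally show ?thesis .
      qed
      finally show "v \<le> 2 * W * (\<Sum>j<J. w j * Mx j x) + 2 * (r J)\<^sup>2" by simp
    qed auto
    have Mx0: "0 \<le> Mx j x" for j x
    proof -
      have "(\<Sum>k<0. a k * D k j x)\<^sup>2 \<le> Mx j x" unfolding Mx_def
        by (rule Max_ge) (simp, rule image_eqI[where x = 0], simp_all)
      then show ?thesis by simp
    qed
    have "(\<Sum>j<J. w j * (18 * (\<Sum>k<n. (a k)\<^sup>2 * (y k j - y k (Suc j)))))
       = (\<Sum>k<n. \<Sum>j<J. 18 * (a k)\<^sup>2 * (w j * (y k j - y k (Suc j))))"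
      unfolding sum_distrib_left by (subst sum.swap) (simp add: mult_ac)
    also have "\<dots> = (\<Sum>k<n. 18 * (a k)\<^sup>2 * (\<Sum>j<J. w j * (y k j - y k (Suc j))))"
      by (simp add: sum_distrib_left)
    also have "\<dots> \<le> (\<Sum>k<n. 18 * (a k)\<^sup>2 * C)"
    proof (intro sum_mono mult_left_mono)
      fix k
      have "(\<Sum>j<J. w j * (y k j - y k (Suc j))) \<le> K\<^sup>2 * (1 + (1 + \<epsilon>) * (\<Sum>j<J. 1 / w j))"
        unfolding w_def using y_bd[of k] \<epsilon> by (intro weighted_telescoping_le) (auto simp: \<phi>_def)
      also have "\<dots> \<le> C"
        unfolding C_def using \<epsilon> by (intro mult_left_mono add_left_mono W) auto
      finally show "(\<Sum>j<J. w j * (y k j - y k (Suc j))) \<le> C" .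
    qed auto
    finally have energy: "(\<Sum>j<J. w j * (18 * (\<Sum>k<n. (a k)\<^sup>2 * (y k j - y k (Suc j)))))
        \<le> 18 * C * (\<Sum>k<n. (a k)\<^sup>2)"
      by (simp add: sum_distrib_left mult_ac)
    have "(LINT x|M. Max ((\<lambda>N. (\<Sum>m<N. a m * Y m 0 x)\<^sup>2) ` {..n}))
        \<le> (LINT x|M. 2 * W * (\<Sum>j<J. w j * Mx j x) + 2 * (r J)\<^sup>2)"
    proof (rule integral_mono')
      show "integrable M (\<lambda>x. 2 * W * (\<Sum>j<J. w j * Mx j x) + 2 * (r J)\<^sup>2)"
        using Mx_int by auto
      show "0 \<le> 2 * W * (\<Sum>j<J. w j * Mx j x) + 2 * (r J)\<^sup>2" for x
        by (intro add_nonneg_nonneg mult_nonneg_nonneg sum_nonneg W0 w0 Mx0) auto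
    qed (rule ptw)
    also have "\<dots> = 2 * W * (\<Sum>j<J. w j * (LINT x|M. Mx j x)) + 2 * (r J)\<^sup>2"
      using Mx_int by (simp add: prob_space)
    also have "\<dots> \<le> 2 * W * (\<Sum>j<J. w j * (18 * (\<Sum>k<n. (a k)\<^sup>2 * (y k j - y k (Suc j))))) + 2 * (r J)\<^sup>2"
      using W0 by (intro add_right_mono mult_left_mono sum_mono Mx_le w0) auto
    also have "\<dots> \<le> 2 * W * (18 * C * (\<Sum>k<n. (a k)\<^sup>2)) + 2 * (r J)\<^sup>2"
      using W0 by (intro add_right_mono mult_left_mono energy) auto
    finally show ?thesis by (simp add: V_def)
  qed
  have "(\<lambda>j. K * real (Suc j) powr - (1/2 + \<epsilon>)) \<longlonglongrightarrow> 0"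
    using \<epsilon> by (intro tendsto_mult_right_zero tendsto_neg_powr
        filterlim_compose[OF filterlim_real_sequentially filterlim_Suc]) auto
  then have "\<phi> \<longlonglongrightarrow> 0" unfolding \<phi>_def powr_minus_divide by simp
  then have "(\<lambda>J. V * (\<Sum>m<n. (a m)\<^sup>2) + 2 * (r J)\<^sup>2) \<longlonglongrightarrow> V * (\<Sum>m<n. (a m)\<^sup>2) + 2 * ((\<Sum>k<n. \<bar>a k\<bar>) * 0)\<^sup>2"
    unfolding r_def by (intro tendsto_intros)
  then have "(\<lambda>J. V * (\<Sum>m<n. (a m)\<^sup>2) + 2 * (r J)\<^sup>2) \<longlonglongrightarrow> V * (\<Sum>m<n. (a m)\<^sup>2)" by simp
  from LIMSEQ_le_const[OF this] trunc
  have "(LINT x|M. Max ((\<lambda>N. (\<Sum>m<N. a m * Y m 0 x)\<^sup>2) ` {..n})) \<le> V * (\<Sum>m<n. (a m)\<^sup>2)"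
    by blast
  then show ?thesis by (simp only: V_def C_def mult.assoc)
qed

text \<open>
  For \<open>\<epsilon> \<le> 1/2\<close> the decay alone does not make \<open>\<Sum>\<^sub>j \<parallel>Y m j\<parallel>\<close> converge; the gain comes from the
  orthogonality of the differences \<open>Y m j - Y m (Suc j)\<close>, which enters through the maximal inequality.
\<close>

lemma AE_summable_reverse_martingale:
  fixes Y :: "nat \<Rightarrow> nat \<Rightarrow> 'a \<Rightarrow> real" and a :: "nat \<Rightarrow> real"
  assumes Y: "\<And>m j. Y m j \<in> borel_measurable (F (m + j))"
    and decay: "\<And>m j x. \<bar>Y m j x\<bar> \<le> K / real (Suc j) powr (1/2 + \<epsilon>)"
    and tower: "\<And>m j A. A \<in> sets (F (Suc (m + j))) \<Longrightarrow> (LINT x:A|M. Y m j x) = (LINT x:A|M. Y m (Suc j) x)"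
    and \<epsilon>: "\<epsilon> > 0" and a: "summable (\<lambda>m. (a m)\<^sup>2)"
  shows "AE x in M. summable (\<lambda>m. a m * Y m 0 x)"
proof -
  define W where "W = (\<Sum>j. 1 / real (Suc j) powr (1 + \<epsilon>))"
  have W0: "0 \<le> W"
    unfolding W_def by (rule suminf_nonneg[OF summable_inverse_powr[OF \<epsilon>]]) simp
  have YM[measurable]: "Y m j \<in> borel_measurable M" for m j
    using Y by (rule measurable_F_imp_M)
  show ?thesis
  proof (rule AE_summable_if_maximal_inequality[where Z = "\<lambda>m x. a m * Y m 0 x" and B = "\<lambda>m. \<bar>a m\<bar> * K" and b = "\<lambda>m. (a m)\<^sup>2"
        and V = "36 * W * K\<^sup>2 * (1 + (1 + \<epsilon>) * W)"])
    show "\<bar>a m * Y m 0 x\<bar> \<le> \<bar>a m\<bar> * K" for m x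
      using decay[of m 0 x] by (auto simp: abs_mult intro!: mult_left_mono)
    fix p n
    interpret shift: reverse_filtration M "\<lambda>k. F (k + p)" by (rule shifted)
    show "(LINT x|M. Max ((\<lambda>N. (\<Sum>m<N. a (p + m) * Y (p + m) 0 x)\<^sup>2) ` {..n}))
      \<le> 36 * W * K\<^sup>2 * (1 + (1 + \<epsilon>) * W) * (\<Sum>m<n. (a (p + m))\<^sup>2)"
      unfolding W_def
    proof (rule shift.maximal_inequality[of "\<lambda>m. Y (p + m)", OF _ decay _ \<epsilon>])
      show "Y (p + m) j \<in> borel_measurable (F (m + j + p))" for m j
        using Y[of "p + m" j] by (simp add: add_ac)
      show "(LINT x:A|M. Y (p + m) j x) = (LINT x:A|M. Y (p + m) (Suc j) x)"
        if "A \<in> sets (F (Suc (m + j) + p))" for m j A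
        using tower[of A "p + m" j] that by (simp add: add_ac)
    qed
  next
    show "0 \<le> 36 * W * K\<^sup>2 * (1 + (1 + \<epsilon>) * W)"
      using \<epsilon> W0 by simp
    show "(\<lambda>x. a m * Y m 0 x) \<in> borel_measurable M" for m by measurable
    show "summable (\<lambda>m. (a m)\<^sup>2)" by (rule a)
    show "0 \<le> (a m)\<^sup>2" for m by simp
  qed
qed

end

section \<open>Contraction of the transfer operator\<close>

definition riesz_factor :: "complex \<Rightarrow> real \<Rightarrow> real" where
  "riesz_factor c t = 1 + Re (c * cis (2 * pi * t))"

text \<open>
  The Ruelle operator of the map \<open>u \<mapsto> q u\<close> modulo \<open>1\<close>, whose weight is a factor of the Riesz product.
\<close>

definition transfer :: "nat \<Rightarrow> complex \<Rightarrow> (real \<Rightarrow> real) \<Rightarrow> real \<Rightarrow> real" where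
  "transfer q c h y = (\<Sum>i<q. riesz_factor c ((y + real i) / q) * h ((y + real i) / q)) / q"

text \<open>
  Adding two branches moves the centre \<open>q / 2\<close> by one, so the old terms reappear and the two new extreme terms
  add up to \<open>q + 1\<close>. The bound is attained for odd \<open>q\<close> at \<open>y = 0\<close>, and it is what makes the contraction
  factor smaller than \<open>1\<close> for \<open>q = 3\<close>.
\<close>

lemma sum_abs_branch_le:
  fixes y :: real
  assumes "0 \<le> y" "y \<le> 1"
  shows "(\<Sum>i<q. \<bar>y + real i - real q / 2\<bar>) \<le> ((real q)\<^sup>2 + 1) / 4"
proof (induction q rule: induct_nat_012)
  case (ge2 n)
  define g where "g i = \<bar>y + real i - real (Suc (Suc n)) / 2\<bar>" for i
  have "(\<Sum>i<Suc (Suc n). g i) = g 0 + (\<Sum>i<n. g (Suc i)) + g (Suc n)"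
    unfolding sum.lessThan_Suc_shift[of g "Suc n"] by simp
  also have "(\<Sum>i<n. g (Suc i)) = (\<Sum>i<n. \<bar>y + real i - real n / 2\<bar>)"
    by (intro sum.cong) (auto simp: g_def field_simps)
  also have "g 0 + (\<Sum>i<n. \<bar>y + real i - real n / 2\<bar>) + g (Suc n) =
      (\<Sum>i<n. \<bar>y + real i - real n / 2\<bar>) + real n + 1"
    using assms by (simp add: g_def abs_if field_simps)
  finally show ?case
    using ge2 unfolding g_def by (simp add: power2_eq_square field_simps)
qed (use assms in \<open>auto simp: abs_if\<close>)

lemma sum_cis_equidistant:
  assumes "q \<ge> 2"
  shows "(\<Sum>i<q. cis (2 * pi * ((y + real i) / q))) = 0"
proof -
  define z where "z = cis (2 * pi / q)"
  have "z \<noteq> 1"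
  proof
    assume "z = 1"
    then have "cis (2 * pi / q) = cis (2 * pi * real 0 / q)" by (simp add: z_def)
    then have "cos (2 * pi / q) = 1" by (simp add: complex_eq_iff)
    then obtain k where k: "2 * pi / q = real_of_int k * 2 * pi"
      by (auto simp: cos_one_2pi_int)
    then have "1 = real_of_int k * real q" using assms by (simp add: field_simps)
    then have "1 = k * int q" by (metis of_int_1 of_int_eq_iff of_int_mult of_int_of_nat_eq)
    then have "int q dvd 1" by (metis dvd_triv_right)
    then show False using assms by simp
  qed
  moreover have "z ^ q = 1" using assms by (simp add: z_def Complex.DeMoivre)
  ultimately have "(\<Sum>i<q. z ^ i) = 0" by (simp add: geometric_sum)
  moreover have "cis (2 * pi * ((y + real i) / q)) = cis (2 * pi * y / q) * z ^ i" for i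
    by (simp add: z_def Complex.DeMoivre cis_mult)
      (simp add: field_simps flip: add_divide_distrib)
  ultimately show ?thesis by (simp add: sum_distrib_left[symmetric])
qed

lemma norm_cis_diff_le: "norm (cis x - cis y) \<le> \<bar>x - y\<bar>"
proof -
  have "cis x - cis y = cis ((x+y)/2) * (cis ((x-y)/2) - cis (-((x-y)/2)))"
    by (simp add: cis_mult algebra_simps) (simp add: field_simps)
  then have "norm (cis x - cis y) = norm (cis ((x-y)/2) - cis (-((x-y)/2)))"
    by (simp add: norm_mult)
  also have "\<dots> = 2 * \<bar>sin ((x-y)/2)\<bar>"
    by (simp add: cmod_def real_sqrt_mult)
  also have "\<dots> \<le> \<bar>x - y\<bar>" using abs_sin_x_le_abs_x[of "(x-y)/2"] by simp
  finally show ?thesis .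
qed

lemma sum_riesz_factor:
  assumes "q \<ge> 2"
  shows "(\<Sum>i<q. riesz_factor c ((y + real i) / q)) = real q"
proof -
  have "(\<Sum>i<q. Re (c * cis (2 * pi * ((y + real i) / q)))) = Re (c * (\<Sum>i<q. cis (2 * pi * ((y + real i) / q))))"
    by (simp only: sum_distrib_left Re_sum)
  also have "\<dots> = 0" unfolding sum_cis_equidistant[OF assms] by simp
  finally show ?thesis unfolding riesz_factor_def sum.distrib by simp
qed

lemma riesz_factor_bounds:
  assumes "norm c \<le> 1"
  shows "0 \<le> riesz_factor c t" "riesz_factor c t \<le> 2"
  using abs_Re_le_cmod[of "c * cis (2 * pi * t)"] assms
  by (auto simp: norm_mult riesz_factor_def)

text \<open>
  Compare the branches of \<open>x\<close> and \<open>y\<close> one by one. The change of \<open>h\<close> contributes \<open>A \<bar>x - y\<bar> / q + e\<close>. The change of the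
  weights is at most \<open>2 \<pi> \<bar>x - y\<bar> / q\<close>; as the weights have constant sum, \<open>h\<close> may be replaced by \<open>h - h (1/2)\<close>,
  whose average over the branches is at most \<open>5/18 A + e\<close>. Altogether the factor of \<open>A\<close> is at most
  \<open>(1 + 5 \<pi> / 9) / 3 < 23/25\<close>.
\<close>

lemma transfer_contraction:
  fixes h :: "real \<Rightarrow> real"
  assumes q: "q \<ge> 3" and c: "norm c \<le> 1"
    and h: "\<And>x y. x \<in> {0..<1} \<Longrightarrow> y \<in> {0..<1} \<Longrightarrow> \<bar>h x - h y\<bar> \<le> A * \<bar>x - y\<bar> + e"
    and A: "0 \<le> A" and e: "0 \<le> e"
    and x: "x \<in> {0..<1}" and y: "y \<in> {0..<1}"
  shows "\<bar>transfer q c h x - transfer q c h y\<bar> \<le> (23/25 * A + 3 * e) * \<bar>x - y\<bar> + e"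
proof -
  define u where "u z i = (z + real i) / q" for z i
  define p where "p z i = riesz_factor c (u z i)" for z i
  have q0: "real q \<ge> 3" using q by simp
  have u: "u z i \<in> {0..<1}" if "z \<in> {0..<1}" "i < q" for z i
  proof -
    have "real i + 1 \<le> real q" using that(2) by linarith
    then have "z + real i < real q" using that(1) by simp
    then show ?thesis using that q0 by (auto simp: u_def divide_simps)
  qed
  have u_diff: "\<bar>u x i - u y i\<bar> = \<bar>x - y\<bar> / q" for i
    using q0 by (simp add: u_def diff_divide_distrib[symmetric])
  have sum_p: "(\<Sum>i<q. p z i) = real q" for z
    unfolding p_def u_def using q by (intro sum_riesz_factor) auto
  have p0: "0 \<le> p z i" for z i
    unfolding p_def using riesz_factor_bounds[OF c] by simp
  have p_diff: "\<bar>p x i - p y i\<bar> \<le> 2 * pi * \<bar>x - y\<bar> / q" for i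
  proof -
    have "p x i - p y i = Re (c * (cis (2 * pi * u x i) - cis (2 * pi * u y i)))"
      by (simp add: p_def riesz_factor_def algebra_simps)
    also have "\<bar>\<dots>\<bar> \<le> norm c * norm (cis (2 * pi * u x i) - cis (2 * pi * u y i))"
      by (metis abs_Re_le_cmod norm_mult)
    also have "\<dots> \<le> 1 * \<bar>2 * pi * u x i - 2 * pi * u y i\<bar>"
      by (intro mult_mono c norm_cis_diff_le) auto
    also have "\<dots> = 2 * pi * \<bar>u x i - u y i\<bar>" 
      by (simp add: abs_mult right_diff_distrib[symmetric] del: right_diff_distrib)
    finally show ?thesis by (simp add: u_diff)
  qed
  have mid: "(\<Sum>i<q. \<bar>u y i - 1/2\<bar>) \<le> 5/18 * q"
  proof -
    have "(\<Sum>i<q. \<bar>u y i - 1/2\<bar>) = (\<Sum>i<q. \<bar>y + real i - real q / 2\<bar>) / q"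
      unfolding sum_divide_distrib using q0 by (intro sum.cong) (auto simp: u_def abs_divide[symmetric] field_simps)
    also have "\<dots> \<le> (((real q)\<^sup>2 + 1) / 4) / q"
      using y q0 by (intro divide_right_mono sum_abs_branch_le) auto
    also have "\<dots> \<le> 5/18 * q"
      using q0 mult_mono[OF q0 q0] by (simp add: field_simps power2_eq_square)
    finally show ?thesis .
  qed
  let ?D = "\<bar>x - y\<bar>"
  have "real q * (transfer q c h x - transfer q c h y) = (\<Sum>i<q. p x i * h (u x i)) - (\<Sum>i<q. p y i * h (u y i))"
    using q0 by (simp add: transfer_def p_def u_def diff_divide_distrib[symmetric])
  also have "\<dots> = (\<Sum>i<q. p x i * (h (u x i) - h (u y i))) + (\<Sum>i<q. (p x i - p y i) * (h (u y i) - h (1/2)))"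
  proof -
    have "(\<Sum>i<q. (p x i - p y i) * h (1/2)) = 0"
      using sum_p by (simp add: sum_distrib_right[symmetric] sum_subtractf)
    then show ?thesis
      by (simp add: algebra_simps sum.distrib sum_subtractf)
  qed
  finally have split: "real q * (transfer q c h x - transfer q c h y) =
      (\<Sum>i<q. p x i * (h (u x i) - h (u y i))) + (\<Sum>i<q. (p x i - p y i) * (h (u y i) - h (1/2)))" .
  have "\<bar>real q * (transfer q c h x - transfer q c h y)\<bar> \<le> (\<Sum>i<q. p x i * (A * (?D / q) + e)) + (\<Sum>i<q. (2 * pi * ?D / q) * (A * \<bar>u y i - 1/2\<bar> + e))"
  proof -
    have "\<bar>\<Sum>i<q. p x i * (h (u x i) - h (u y i))\<bar> \<le> (\<Sum>i<q. p x i * (A * (?D / q) + e))"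
    proof (rule order.trans[OF sum_abs], rule sum_mono)
      fix i assume "i \<in> {..<q}"
      then show "\<bar>p x i * (h (u x i) - h (u y i))\<bar> \<le> p x i * (A * (?D / q) + e)"
        using h[OF u[OF x] u[OF y], of i i] p0[of x i] unfolding abs_mult u_diff
        by (intro mult_mono) auto
    qed
    moreover have "\<bar>\<Sum>i<q. (p x i - p y i) * (h (u y i) - h (1/2))\<bar> \<le> (\<Sum>i<q. (2 * pi * ?D / q) * (A * \<bar>u y i - 1/2\<bar> + e))"
    proof (rule order.trans[OF sum_abs], rule sum_mono)
      fix i assume "i \<in> {..<q}"
      then show "\<bar>(p x i - p y i) * (h (u y i) - h (1/2))\<bar> \<le> (2 * pi * ?D / q) * (A * \<bar>u y i - 1/2\<bar> + e)"
        using h[OF u[OF y], of i "1/2"] p_diff[of i] unfolding abs_mult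
        by (intro mult_mono) auto
    qed
    ultimately show ?thesis unfolding split by linarith
  qed
  also have "\<dots> = real q * (A * (?D / q) + e) + (2 * pi * ?D / q) * (A * (\<Sum>i<q. \<bar>u y i - 1/2\<bar>) + q * e)"
  proof -
    have "(\<Sum>i<q. p x i * (A * (?D / q) + e)) = real q * (A * (?D / q) + e)"
      by (simp only: sum_distrib_right[symmetric] sum_p)
    moreover have "(\<Sum>i<q. (2 * pi * ?D / q) * (A * \<bar>u y i - 1/2\<bar> + e)) =
        (2 * pi * ?D / q) * (A * (\<Sum>i<q. \<bar>u y i - 1/2\<bar>) + (\<Sum>i<q. e))"
      by (simp only: sum_distrib_left[symmetric] sum.distrib)
    ultimately show ?thesis by simp
  qed
  also have "\<dots> \<le> real q * (A * (?D / q) + e) + (2 * pi * ?D / q) * (A * (5/18 * q) + q * e)"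
    using mid A q0 by (intro add_left_mono mult_left_mono add_right_mono) auto
  also have "\<dots> = A * ?D + real q * e + 2 * pi * ?D * (A * (5/18) + e)"
    using q0 by (simp add: field_simps)
  also have "\<dots> \<le> A * ?D + real q * e + 63/10 * ?D * (A * (5/18) + e)"
    using pi_approx(2) A e by (intro add_left_mono mult_right_mono) auto
  also have "\<dots> = 11/4 * A * ?D + 63/10 * e * ?D + real q * e" by (simp add: field_simps)
  also have "\<dots> \<le> real q * (23/25 * A) * ?D + real q * (3 * e) * ?D + real q * e"
  proof -
    have "3 * (23/25 * A) \<le> real q * (23/25 * A)" using q0 A by (intro mult_right_mono) auto
    then have "11/4 * A \<le> real q * (23/25 * A)" using A by linarith
    moreover have "3 * (3 * e) \<le> real q * (3 * e)" using q0 e by (intro mult_right_mono) auto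
    then have "63/10 * e \<le> real q * (3 * e)" using e by linarith
    ultimately show ?thesis by (intro add_right_mono add_mono mult_right_mono) auto
  qed
  also have "\<dots> = real q * ((23/25 * A + 3 * e) * ?D + e)" by (simp add: algebra_simps)
  finally have "real q * \<bar>transfer q c h x - transfer q c h y\<bar> \<le> real q * ((23/25 * A + 3 * e) * ?D + e)"
    using q0 by (simp add: abs_mult)
  then show ?thesis using q0 by simp
qed

text \<open>
  The operators from time \<open>m\<close> to time \<open>m + j\<close>; the result describes a function of \<open>l m * x\<close> averaged over
  the points with the same value of \<open>l (m + j) * x\<close> modulo \<open>1\<close>.
\<close>

primrec transfer_iterate :: "(nat \<Rightarrow> nat) \<Rightarrow> (nat \<Rightarrow> complex) \<Rightarrow> nat \<Rightarrow> nat \<Rightarrow> (real \<Rightarrow> real) \<Rightarrow> real \<Rightarrow> real" where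
  "transfer_iterate q c m 0 h = h"
| "transfer_iterate q c m (Suc j) h = transfer (q (m + j)) (c (m + j)) (transfer_iterate q c m j h)"

text \<open>
  The additive error \<open>e\<close> is passed on unchanged, while its feedback into the Lipschitz constant sums to
  the geometric series \<open>3 e (1 + 23/25 + ...) = 37.5 e\<close>, rounded up to \<open>38 e\<close>.
\<close>

lemma transfer_iterate_oscillation:
  assumes q: "\<And>n. q n \<ge> 3" and c: "\<And>n. norm (c n) \<le> 1"
    and h: "\<And>x y. x \<in> {0..<1} \<Longrightarrow> y \<in> {0..<1} \<Longrightarrow> \<bar>h x - h y\<bar> \<le> A * \<bar>x - y\<bar> + e"
    and A: "0 \<le> A" and e: "0 \<le> e"
    and x: "x \<in> {0..<1}" and y: "y \<in> {0..<1}"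
  shows "\<bar>transfer_iterate q c m j h x - transfer_iterate q c m j h y\<bar> \<le> (23/25) ^ j * A + 39 * e"
proof -
  have "\<bar>transfer_iterate q c m j h x - transfer_iterate q c m j h y\<bar> \<le> ((23/25) ^ j * A + 38 * e) * \<bar>x - y\<bar> + e"
    if "x \<in> {0..<1}" "y \<in> {0..<1}" for x y
    using that
  proof (induction j arbitrary: x y)
    case 0
    have "A * \<bar>x - y\<bar> \<le> (A + 38 * e) * \<bar>x - y\<bar>" using e by (intro mult_right_mono) auto
    then show ?case using h[OF 0] by simp
  next
    case (Suc j)
    have "\<bar>transfer_iterate q c m (Suc j) h x - transfer_iterate q c m (Suc j) h y\<bar>
      \<le> (23/25 * ((23/25) ^ j * A + 38 * e) + 3 * e) * \<bar>x - y\<bar> + e"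
      unfolding transfer_iterate.simps
      by (rule transfer_contraction[OF q c Suc.IH _ e Suc.prems]) (use A e in auto)
    also have "\<dots> \<le> ((23/25) ^ Suc j * A + 38 * e) * \<bar>x - y\<bar> + e"
      using e by (intro add_right_mono mult_right_mono) (auto simp: algebra_simps)
    finally show ?case .
  qed
  from this[OF x y] have "\<bar>transfer_iterate q c m j h x - transfer_iterate q c m j h y\<bar> \<le> ((23/25) ^ j * A + 38 * e) * \<bar>x - y\<bar> + e" .
  also have "\<dots> \<le> ((23/25) ^ j * A + 38 * e) * 1 + e"
    using x y A e by (intro add_right_mono mult_left_mono) auto
  finally show ?thesis by simp
qed

text \<open>
  Join \<open>x\<close> to \<open>y\<close> by at most \<open>\<bar>x - y\<bar> / \<eta> + 1\<close> steps of length at most \<open>\<eta>\<close>.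
\<close>

lemma coarse_Lipschitz:
  fixes f :: "real \<Rightarrow> real"
  assumes f: "\<And>x y. x \<in> {0..1} \<Longrightarrow> y \<in> {0..1} \<Longrightarrow> \<bar>x - y\<bar> \<le> \<eta> \<Longrightarrow> \<bar>f x - f y\<bar> \<le> w"
    and \<eta>: "0 < \<eta>" and w: "0 \<le> w" and x: "x \<in> {0..1}" and y: "y \<in> {0..1}"
  shows "\<bar>f x - f y\<bar> \<le> w / \<eta> * \<bar>x - y\<bar> + w"
proof -
  define n where "n = nat \<lfloor>\<bar>x - y\<bar> / \<eta>\<rfloor> + 1"
  have n: "\<bar>x - y\<bar> / \<eta> < real n" "real n \<le> \<bar>x - y\<bar> / \<eta> + 1"
    using \<eta> by (auto simp: n_def of_nat_nat) linarith+
  have n0: "n > 0" by (simp add: n_def)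
  define p where "p k = x + real k * ((y - x) / n)" for k
  have pI: "p k \<in> {0..1}" if "k \<le> n" for k
  proof -
    have "p k = (1 - real k / n) * x + real k / n * y" using n0 by (simp add: p_def field_simps)
    moreover have "0 \<le> real k / n" "real k / n \<le> 1" using that n0 by auto
    ultimately show ?thesis
      using x y convexD[OF convex_real_interval(5)[of 0 1] x y, of "1 - real k / n" "real k / n"] by simp
  qed
  have "\<bar>f (p k) - f x\<bar> \<le> real k * w" if "k \<le> n" for k
    using that
  proof (induction k)
    case 0
    then show ?case by (simp add: p_def)
  next
    case (Suc k)
    define \<delta> where "\<delta> = (y - x) / n"
    have "p (Suc k) - p k = (y - x) / n"
      unfolding p_def \<delta>_def[symmetric] by (simp add: algebra_simps)
    then have "\<bar>p (Suc k) - p k\<bar> = \<bar>x - y\<bar> / n" by (simp add: abs_minus_commute)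
    also have "\<dots> \<le> \<eta>" using n(1) n0 \<eta> by (simp add: field_simps)
    finally have "\<bar>f (p (Suc k)) - f (p k)\<bar> \<le> w" using f pI Suc.prems by simp
    then show ?case using Suc by (simp add: algebra_simps)
  qed
  from this[of n] have "\<bar>f x - f y\<bar> \<le> real n * w"
    using n0 by (simp add: p_def abs_minus_commute)
  also have "\<dots> \<le> (\<bar>x - y\<bar> / \<eta> + 1) * w" using n(2) w by (intro mult_right_mono)
  finally show ?thesis by (simp add: algebra_simps)
qed

section \<open>Riesz products and the transfer operator on continuous functions\<close>

definition periodic_continuous :: "(real \<Rightarrow> real) \<Rightarrow> bool" where
  "periodic_continuous h \<longleftrightarrow> continuous_on UNIV h \<and> (\<forall>t. h (t + 1) = h t)"

lemma periodic_continuous_add_nat: "periodic_continuous h \<Longrightarrow> h (t + real n) = h t"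
proof (induction n)
  case (Suc n)
  then have "h ((t + real n) + 1) = h (t + real n)" by (auto simp: periodic_continuous_def)
  with Suc show ?case by (simp add: add_ac)
qed simp

lemma periodic_continuous_frac: 
  assumes "periodic_continuous h"
  shows "h (frac t) = h t"
proof (cases "t \<ge> 0")
  case True
  then have "t = frac t + real (nat \<lfloor>t\<rfloor>)" by (simp add: frac_def)
  then show ?thesis using periodic_continuous_add_nat[OF assms] by metis
next
  case False
  then have "frac t = t + real (nat (- \<lfloor>t\<rfloor>))" by (simp add: frac_def)
  then show ?thesis using periodic_continuous_add_nat[OF assms] by simp
qed

lemma periodic_continuous_mult: "periodic_continuous g \<Longrightarrow> periodic_continuous h \<Longrightarrow> periodic_continuous (\<lambda>t. g t * h t)"
  by (auto simp: periodic_continuous_def intro!: continuous_intros)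

lemma periodic_continuous_prod: "(\<And>k. k \<in> I \<Longrightarrow> periodic_continuous (g k)) \<Longrightarrow> periodic_continuous (\<lambda>t. \<Prod>k\<in>I. g k t)"
  by (auto simp: periodic_continuous_def intro!: continuous_intros prod.cong)

lemma periodic_continuous_scale:
  assumes "periodic_continuous h"
  shows "periodic_continuous (\<lambda>t. h (real n * t))"
  unfolding periodic_continuous_def
proof
  have "continuous_on UNIV h" using assms by (simp add: periodic_continuous_def)
  then show "continuous_on UNIV (\<lambda>t. h (real n * t))"
    by (rule continuous_on_compose2[where f = "\<lambda>t. real n * t"]) (auto intro!: continuous_intros)
  show "\<forall>t. h (real n * (t + 1)) = h (real n * t)"
    using periodic_continuous_add_nat[OF assms, of "real n * _" n] by (simp add: algebra_simps)
qed

lemma periodic_continuous_riesz_factor: "periodic_continuous (riesz_factor c)"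
  unfolding periodic_continuous_def riesz_factor_def
proof (intro conjI allI)
  show "continuous_on UNIV (\<lambda>t. 1 + Re (c * cis (2 * pi * t)))"
    by (intro continuous_intros)
  show "1 + Re (c * cis (2 * pi * (t + 1))) = 1 + Re (c * cis (2 * pi * t))" for t
    by (simp add: distrib_left sin_add cos_add)
qed

lemma periodic_continuous_transfer:
  assumes "periodic_continuous h" and "q > 0"
  shows "periodic_continuous (transfer q c h)"
proof -
  define g where "g = (\<lambda>t. riesz_factor c t * h t)"
  have g: "periodic_continuous g" unfolding g_def by (intro periodic_continuous_mult periodic_continuous_riesz_factor assms)
  then have cont: "continuous_on UNIV (\<lambda>y. g ((y + real i) / real q))" for i
    by (intro continuous_on_compose2[where g = g and f = "\<lambda>y. (y + real i) / real q"])
      (use assms in \<open>auto simp: periodic_continuous_def intro!: continuous_intros\<close>)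
  have "(\<Sum>i<q. g ((y + 1 + real i) / q)) = (\<Sum>i<q. g ((y + real i) / q))" for y
  proof -
    define a where "a i = g ((y + real i) / q)" for i
    have "a q = g (y / q + real 1)" using assms by (simp add: a_def add_divide_distrib)
    then have "a q = a 0" unfolding periodic_continuous_add_nat[OF g] by (simp add: a_def)
    then have "(\<Sum>i<q. a (Suc i)) = (\<Sum>i<q. a i)"
      using sum.lessThan_Suc_shift[of a q] by simp
    then show ?thesis by (simp add: a_def add_ac)
  qed
  moreover have "transfer q c h = (\<lambda>y. (\<Sum>i<q. g ((y + real i) / q)) / q)"
    by (simp add: fun_eq_iff transfer_def g_def)
  moreover have "continuous_on UNIV (\<lambda>y. (\<Sum>i<q. g ((y + real i) / q)) / q)"
    using assms(2) by (intro continuous_intros cont) auto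
  ultimately show ?thesis by (simp add: periodic_continuous_def)
qed

lemma integral_branches:
  fixes g :: "real \<Rightarrow> real"
  assumes g: "continuous_on UNIV g" and q: "q > 0"
  shows "integral {0..1} g = (\<Sum>i<q. integral {0..1} (\<lambda>w. g ((w + real i) / q))) / q"
proof -
  have int: "g integrable_on {a..b}" for a b
    by (intro integrable_continuous_real continuous_on_subset[OF g]) auto
  have piece: "integral {real n / q..real (Suc n) / q} g = integral {0..1} (\<lambda>w. g ((w + real n) / q)) / q" for n
  proof -
    have "(g has_integral integral {real n / q..real (Suc n) / q} g) (cbox (real n / q) (real (Suc n) / q))"
      using int by (simp add: integrable_integral)
    from has_integral_affinity[OF this, of "1 / q" "real n / q"] q
    have "((\<lambda>w. g ((w + real n) / q)) has_integral real q * integral {real n / q..real (Suc n) / q} g)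
       ((\<lambda>x. real q * x - real n) ` {real n / q..real (Suc n) / q})"
      by (simp add: add_divide_distrib)
    also have "(\<lambda>x. real q * x - real n) ` {real n / q..real (Suc n) / q} = {0..1}"
      using q image_affinity_atLeastAtMost_diff[of "real q" "real n" "real n / q" "real (Suc n) / q"]
      by (simp add: divide_right_mono)
    finally show ?thesis using q by (simp add: integral_unique)
  qed
  have "integral {0..real n / q} g = (\<Sum>i<n. integral {0..1} (\<lambda>w. g ((w + real i) / q))) / q" for n
  proof (induction n)
    case (Suc n)
    have "integral {0..real (Suc n) / q} g = integral {0..real n / q} g + integral {real n / q..real (Suc n) / q} g"
      by (rule Henstock_Kurzweil_Integration.integral_combine[symmetric]) (use q int in \<open>auto simp: divide_right_mono\<close>)
    then show ?case unfolding piece using Suc by (simp add: add_divide_distrib)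
  qed simp
  from this[of q] q show ?thesis by simp
qed

text \<open>
  Duality: the operator is the adjoint, with respect to the weight, of composition with
  \<open>v \<mapsto> q v\<close>. It is the change of variables \<open>v = (w + i) / q\<close> on each of the \<open>q\<close> branches.
\<close>

lemma integral_transfer:
  assumes h: "periodic_continuous h" and g: "periodic_continuous g" and q: "q > 0"
  shows "integral {0..1} (\<lambda>v. riesz_factor c v * h v * g (real q * v))
    = integral {0..1} (\<lambda>w. transfer q c h w * g w)"
proof -
  define G where "G = (\<lambda>v. riesz_factor c v * h v * g (real q * v))"
  have "periodic_continuous G"
    unfolding G_def by (intro periodic_continuous_mult periodic_continuous_riesz_factor periodic_continuous_scale h g)
  then have G: "continuous_on UNIV G" by (simp add: periodic_continuous_def)
  have branch: "G ((w + real i) / q) = riesz_factor c ((w + real i) / q) * h ((w + real i) / q) * g w" for w i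
    using q periodic_continuous_add_nat[OF g] by (simp add: G_def)
  have contG: "continuous_on {0..1} (\<lambda>w. G ((w + real i) / q))" for i
    by (rule continuous_on_compose2[OF G]) (use q in \<open>auto intro!: continuous_intros\<close>)
  have "integral {0..1} G = (\<Sum>i<q. integral {0..1} (\<lambda>w. G ((w + real i) / q))) / q"
    using G q by (rule integral_branches)
  also have "\<dots> = integral {0..1} (\<lambda>w. (\<Sum>i<q. G ((w + real i) / q)) / q)"
    using contG by (subst integral_divide, subst integral_sum) (auto intro!: integrable_continuous_real)
  also have "\<dots> = integral {0..1} (\<lambda>w. transfer q c h w * g w)"
    by (simp add: branch transfer_def sum_distrib_right)
  finally show ?thesis unfolding G_def .
qed

lemma transfer_const: "q \<ge> 2 \<Longrightarrow> transfer q c (\<lambda>_. 1) y = 1"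
  using sum_riesz_factor[of q c y] by (simp add: transfer_def)

lemma periodic_continuous_1: "periodic_continuous (\<lambda>_. 1)"
  by (simp add: periodic_continuous_def)

text \<open>
  The partial products average to \<open>1\<close> over the fibres of \<open>x \<mapsto> l m x\<close>. Each step of the induction uses that
  the operator fixes the constant \<open>1\<close>.
\<close>

lemma integral_riesz_density:
  fixes l q :: "nat \<Rightarrow> nat"
  assumes l: "l 0 > 0" "\<And>n. l (Suc n) = q n * l n" and q: "\<And>n. q n \<ge> 2" and h: "periodic_continuous h"
  shows "integral {0..1} (\<lambda>x. (\<Prod>k<m. riesz_factor (c k) (l k * x)) * h (l m * x)) = integral {0..1} h"
  using h
proof (induction m arbitrary: h)
  case 0
  have "integral {0..1} (\<lambda>x. h (real (l 0) * x)) = integral {0..1} h"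
    using periodic_continuous_scale[OF 0, of "l 0"] l(1) periodic_continuous_add_nat[OF 0]
    by (subst integral_branches[of _ "l 0"]) (auto simp: periodic_continuous_def)
  then show ?case by simp
next
  case (Suc m)
  have q0: "q m > 0" using q[of m] by simp
  have "(\<Prod>k<Suc m. riesz_factor (c k) (l k * x)) * h (l (Suc m) * x) =
      (\<Prod>k<m. riesz_factor (c k) (l k * x)) * (riesz_factor (c m) (l m * x) * h (q m * (l m * x)))" for x :: real
    by (simp add: l(2) mult_ac)
  then have "integral {0..1} (\<lambda>x. (\<Prod>k<Suc m. riesz_factor (c k) (l k * x)) * h (l (Suc m) * x))
      = integral {0..1} (\<lambda>x. (\<Prod>k<m. riesz_factor (c k) (l k * x)) *
          (riesz_factor (c m) (l m * x) * h (q m * (l m * x))))"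
    by presburger
  also have "\<dots> = integral {0..1} (\<lambda>v. riesz_factor (c m) v * h (q m * v))"
    by (rule Suc.IH) (intro periodic_continuous_mult periodic_continuous_riesz_factor periodic_continuous_scale Suc.prems)
  also have "\<dots> = integral {0..1} (\<lambda>w. transfer (q m) (c m) (\<lambda>_. 1) w * h w)"
    using integral_transfer[OF periodic_continuous_1 Suc.prems q0, of "c m"] by simp
  finally show ?case using q by (simp add: transfer_const)
qed

text \<open>
  Both sides reduce to the same integral: the factors before \<open>m\<close> average out, the factor \<open>m\<close> is absorbed by the
  operator, and the factors after \<open>m\<close> are a function of \<open>l (Suc m) * x\<close>.
\<close>

lemma integral_riesz_density_transfer:
  fixes l q :: "nat \<Rightarrow> nat"
  assumes l: "l 0 > 0" "\<And>n. l (Suc n) = q n * l n" and q: "\<And>n. q n \<ge> 2" and h: "periodic_continuous h"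
    and N: "m \<le> N"
  shows "integral {0..1} (\<lambda>x. (\<Prod>k\<le>N. riesz_factor (c k) (l k * x)) * h (l m * x))
    = integral {0..1} (\<lambda>x. (\<Prod>k\<le>N. riesz_factor (c k) (l k * x)) * transfer (q m) (c m) h (l (Suc m) * x))"
proof -
  have q0: "q m > 0" using q[of m] by simp
  have dvd: "l (Suc m) dvd l k" if "Suc m \<le> k" for k
    using that by (induction k rule: dec_induct) (auto simp: l(2))
  \<comment> \<open>The factors after \<open>m\<close>, as a function of the frequency \<open>l (Suc m)\<close>, which divides all later ones.\<close>
  define R where "R w = (\<Prod>k=Suc m..N. riesz_factor (c k) (real (l k div l (Suc m)) * w))" for w
  have R: "periodic_continuous R"
    unfolding R_def by (intro periodic_continuous_prod periodic_continuous_scale periodic_continuous_riesz_factor)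
  have tail: "(\<Prod>k=Suc m..N. riesz_factor (c k) (l k * x)) = R (l (Suc m) * x)" for x :: real
    unfolding R_def
  proof (rule prod.cong)
    fix k assume "k \<in> {Suc m..N}"
    then have "l k = (l k div l (Suc m)) * l (Suc m)" using dvd by simp
    then have "real (l k) = real (l k div l (Suc m)) * real (l (Suc m))" by (metis of_nat_mult)
    then show "riesz_factor (c k) (l k * x) = riesz_factor (c k) (real (l k div l (Suc m)) * (l (Suc m) * x))"
      by (simp add: mult_ac)
  qed simp
  have split: "{..N} = {..<Suc m} \<union> {Suc m..N}" using N by auto
  have dens: "(\<Prod>k\<le>N. riesz_factor (c k) (l k * x)) = (\<Prod>k<Suc m. riesz_factor (c k) (l k * x)) * R (l (Suc m) * x)" for x :: real
    unfolding split tail[symmetric] by (rule prod.union_disjoint) auto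
  have "integral {0..1} (\<lambda>x. (\<Prod>k\<le>N. riesz_factor (c k) (l k * x)) * h (l m * x))
     = integral {0..1} (\<lambda>x. (\<Prod>k<m. riesz_factor (c k) (l k * x)) *
         (\<lambda>v. riesz_factor (c m) v * h v * R (q m * v)) (l m * x))"
    unfolding dens by (simp add: l(2) mult_ac)
  also have "\<dots> = integral {0..1} (\<lambda>v. riesz_factor (c m) v * h v * R (q m * v))"
    by (rule integral_riesz_density[OF l q])
      (intro periodic_continuous_mult periodic_continuous_riesz_factor periodic_continuous_scale h R)
  also have "\<dots> = integral {0..1} (\<lambda>w. transfer (q m) (c m) h w * R w)"
    by (rule integral_transfer[OF h R q0])
  also have "\<dots> = integral {0..1} (\<lambda>x. (\<Prod>k<Suc m. riesz_factor (c k) (l k * x)) *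
         (\<lambda>w. transfer (q m) (c m) h w * R w) (l (Suc m) * x))"
    by (rule integral_riesz_density[OF l q, symmetric])
      (intro periodic_continuous_mult periodic_continuous_transfer h R q0)
  finally show ?thesis unfolding dens by (simp add: mult_ac)
qed

lemma integral_circle_lebesgue:
  fixes h :: "real \<Rightarrow> 'b::euclidean_space"
  assumes "continuous_on UNIV h"
  shows "integral\<^sup>L circle_lebesgue h = integral {0..1} h"
proof -
  have meas: "h \<in> borel_measurable borel"
    using assms by (rule borel_measurable_continuous_onI)
  have "integral\<^sup>L circle_lebesgue h = (LINT x:{0..<1}|lborel. h x)"
    by (simp add: circle_lebesgue_def integral_restrict_space set_lebesgue_integral_def)
  also have "\<dots> = (LINT x:{0..1}|lborel. h x)"
    unfolding set_lebesgue_integral_def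
  proof (rule integral_cong_AE)
    show "AE x in lborel. indicat_real {0..<1} x *\<^sub>R h x = indicat_real {0..1} x *\<^sub>R h x"
      using AE_lborel_singleton[of 1] by eventually_elim (auto simp: indicator_def)
  qed (use meas in measurable)
  also have "\<dots> = integral {0..1} h"
    using continuous_on_subset[OF assms]
    by (intro set_borel_integral_eq_integral borel_integrable_atLeastAtMost') auto
  finally show ?thesis .
qed

lemma integral_riesz_partial:
  fixes h :: "real \<Rightarrow> real"
  assumes c: "\<And>n. norm (c n) \<le> 1" and h: "periodic_continuous h"
  shows "integral\<^sup>L (riesz_partial l c N) (\<lambda>t. complex_of_real (h t)) =
    of_real (integral {0..1} (\<lambda>t. (\<Prod>k\<le>N. riesz_factor (c k) (l k * t)) * h t))"
proof -
  define P where "P t = (\<Prod>k\<le>N. riesz_factor (c k) (l k * t))" for t :: real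
  have P: "periodic_continuous P"
    unfolding P_def by (intro periodic_continuous_prod periodic_continuous_scale periodic_continuous_riesz_factor)
  have meas: "g \<in> borel_measurable circle_lebesgue" if "periodic_continuous g" for g
    using that unfolding circle_lebesgue_def periodic_continuous_def
    by (intro measurable_restrict_space1) (auto intro: borel_measurable_continuous_onI)
  have "riesz_partial l c N = density circle_lebesgue P"
    unfolding riesz_partial_def P_def riesz_factor_def
    by (simp add: cis_conv_exp atLeast0AtMost mult_ac)
  then have "integral\<^sup>L (riesz_partial l c N) (\<lambda>t. complex_of_real (h t)) =
      of_real (integral\<^sup>L (density circle_lebesgue P) h)"
    by simp
  also have "integral\<^sup>L (density circle_lebesgue P) h = (LINT t|circle_lebesgue. P t * h t)"
    using meas[OF P] meas[OF h] riesz_factor_bounds(1)[OF c]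
    by (subst integral_real_density) (auto simp: P_def intro!: prod_nonneg)
  also have "\<dots> = integral {0..1} (\<lambda>t. P t * h t)"
    using periodic_continuous_mult[OF P h] by (intro integral_circle_lebesgue) (simp add: periodic_continuous_def)
  finally show ?thesis unfolding P_def .
qed

lemma integral_riesz_product_transfer:
  fixes l q :: "nat \<Rightarrow> nat"
  assumes l: "l 0 > 0" "\<And>n. l (Suc n) = q n * l n" and q: "\<And>n. q n \<ge> 2"
    and c: "\<And>n. norm (c n) \<le> 1" and \<mu>: "is_riesz_product l c \<mu>" and h: "periodic_continuous h"
  shows "(LINT x|\<mu>. h (l m * x)) = (LINT x|\<mu>. transfer (q m) (c m) h (l (Suc m) * x))"
proof -
  have limit: "(\<lambda>N. integral {0..1} (\<lambda>t. (\<Prod>k\<le>N. riesz_factor (c k) (l k * t)) * g t))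
      \<longlonglongrightarrow> (LINT x|\<mu>. g x)" if g: "periodic_continuous g" for g
  proof -
    have "circle_continuous (\<lambda>t. complex_of_real (g t))"
      using g by (auto simp: circle_continuous_def periodic_continuous_def intro!: continuous_intros)
    then have "(\<lambda>N. integral\<^sup>L (riesz_partial l c N) (\<lambda>t. complex_of_real (g t)))
        \<longlonglongrightarrow> integral\<^sup>L \<mu> (\<lambda>t. complex_of_real (g t))"
      using \<mu> unfolding is_riesz_product_def by blast
    then show ?thesis unfolding integral_riesz_partial[OF c g] by (simp add: tendsto_of_real_iff)
  qed
  have q0: "q m > 0" using q[of m] by simp
  have "(\<lambda>N. integral {0..1} (\<lambda>t. (\<Prod>k\<le>N. riesz_factor (c k) (l k * t)) * h (l m * t)))
      \<longlonglongrightarrow> (LINT x|\<mu>. transfer (q m) (c m) h (l (Suc m) * x))"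
  proof (rule Lim_transform_eventually)
    show "(\<lambda>N. integral {0..1} (\<lambda>t. (\<Prod>k\<le>N. riesz_factor (c k) (l k * t)) * transfer (q m) (c m) h (l (Suc m) * t)))
      \<longlonglongrightarrow> (LINT x|\<mu>. transfer (q m) (c m) h (l (Suc m) * x))"
      by (intro limit periodic_continuous_scale periodic_continuous_transfer h q0)
    show "\<forall>\<^sub>F N in sequentially. integral {0..1} (\<lambda>t. (\<Prod>k\<le>N. riesz_factor (c k) (l k * t)) * transfer (q m) (c m) h (l (Suc m) * t))
      = integral {0..1} (\<lambda>t. (\<Prod>k\<le>N. riesz_factor (c k) (l k * t)) * h (l m * t))"
      using eventually_ge_at_top[of m]
      by eventually_elim (rule integral_riesz_density_transfer[OF l q h, symmetric])
  qed
  moreover have "(\<lambda>N. integral {0..1} (\<lambda>t. (\<Prod>k\<le>N. riesz_factor (c k) (l k * t)) * h (l m * t)))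
      \<longlonglongrightarrow> (LINT x|\<mu>. h (l m * x))"
    by (intro limit periodic_continuous_scale h)
  ultimately show ?thesis by (rule LIMSEQ_unique[rotated])
qed

section \<open>Borel measures on the circle\<close>

text \<open>
  The cosine centred at the midpoint of the arc \<open>(a,1)\<close> exceeds its value at the end points exactly on this
  arc. This yields a bump that is visibly continuous and periodic.
\<close>

lemma arc_bump_pos_iff:
  fixes x a :: real
  assumes "0 \<le> x" "x < 1" "0 \<le> a" "a < 1"
  shows "cos (pi * (1 - a)) < cos (2 * pi * (x - (1 + a) / 2)) \<longleftrightarrow> a < x"
proof -
  define d where "d = \<bar>x - (1 + a) / 2\<bar>"
  have hw: "pi * (1 - a) = 2 * pi * ((1 - a) / 2)" by simp
  have d: "cos (2 * pi * (x - (1 + a) / 2)) = cos (2 * pi * d)"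
    unfolding d_def by (simp add: abs_if) (metis cos_minus minus_diff_eq mult_minus_right)
  have mono: "cos (2 * pi * s) < cos (2 * pi * t) \<longleftrightarrow> t < s" if "0 \<le> s" "s \<le> 1/2" "0 \<le> t" "t \<le> 1/2" for s t
    using that by (subst cos_mono_less_eq) auto
  show ?thesis
  proof (cases "d \<le> 1/2")
    case True
    then have "cos (pi * (1 - a)) < cos (2 * pi * (x - (1 + a) / 2)) \<longleftrightarrow> d < (1 - a) / 2"
      unfolding d hw using assms by (intro mono) (auto simp: d_def)
    also have "\<dots> \<longleftrightarrow> a < x"
      using assms by (auto simp: d_def abs_if field_simps)
    finally show ?thesis .
  next
    case False
    have "cos (2 * pi * d) = cos (2 * pi * (1 - d))"
      using cos_2pi_minus[of "2 * pi * d"] by (simp add: right_diff_distrib)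
    moreover have "\<not> cos (2 * pi * ((1 - a) / 2)) < cos (2 * pi * (1 - d))"
      using assms False by (subst mono) (auto simp: d_def abs_if field_simps split: if_splits)
    moreover have "\<not> a < x" using assms False by (auto simp: d_def abs_if field_simps split: if_splits)
    ultimately show ?thesis unfolding d hw by simp
  qed
qed

text \<open>
  The arcs \<open>(a,1)\<close> are the sets \<open>{a<..}\<close> up to null sets, their indicators are limits of continuous periodic
  functions, and the half-lines determine a finite Borel measure. No arc across the base point is required, so an atom
  at \<open>0\<close> causes no difficulty.
\<close>

lemma circle_measure_eqI:
  fixes M N :: "real measure"
  assumes "finite_measure M" "finite_measure N" and sets: "sets M = sets borel" "sets N = sets borel"
    and supp: "emeasure M (- {0..<1}) = 0" "emeasure N (- {0..<1}) = 0"
    and eq: "\<And>h. periodic_continuous h \<Longrightarrow> integral\<^sup>L M h = integral\<^sup>L N h"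
  shows "M = N"
proof -
  interpret M: finite_measure M by fact
  interpret N: finite_measure N by fact
  have arc: "(\<lambda>k. integral\<^sup>L K (\<lambda>x. min 1 (real k * max 0 (cos (2 * pi * (x - (1 + a) / 2)) - cos (pi * (1 - a))))))
      \<longlonglongrightarrow> measure K {a<..}"
    if K: "finite_measure K" "sets K = sets borel" "emeasure K (- {0..<1}) = 0" and a: "0 \<le> a" "a < 1" for K a
  proof -
    interpret K: finite_measure K by fact
    define g where "g x = max 0 (cos (2 * pi * (x - (1 + a) / 2)) - cos (pi * (1 - a)))" for x
    have gm[measurable]: "g \<in> borel_measurable borel"
      unfolding g_def by (intro borel_measurable_continuous_onI continuous_intros)
    have [measurable]: "h \<in> borel_measurable borel \<Longrightarrow> h \<in> borel_measurable K" for h :: "real \<Rightarrow> real"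
      using K(2) by (simp add: measurable_def sets_eq_imp_space_eq[OF K(2)])
    have "AE x in K. x \<in> {0..<1}"
      using K(2,3) sets_eq_imp_space_eq[OF K(2)] by (intro AE_I[of _ _ "- {0..<1}"]) auto
    then have lim: "AE x in K. (\<lambda>k. min 1 (real k * g x)) \<longlonglongrightarrow> indicat_real {a<..} x"
    proof eventually_elim
      case (elim x)
      show ?case
      proof (cases "a < x")
        case True
        then have gx: "g x > 0" using arc_bump_pos_iff[of x a] elim a by (simp add: g_def)
        obtain k0 where k0: "1 < real k0 * g x" using reals_Archimedean3[OF gx] by blast
        have "\<forall>\<^sub>F k in sequentially. min 1 (real k * g x) = 1"
          using eventually_ge_at_top[of k0]
        proof eventually_elim
          case (elim k)
          then have "real k0 * g x \<le> real k * g x" using gx by (intro mult_right_mono) auto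
          with k0 show ?case by simp
        qed
        then show ?thesis using True by (auto intro: tendsto_eventually)
      next
        case False
        then have "g x = 0" using arc_bump_pos_iff[of x a] elim a by (simp add: g_def)
        then show ?thesis using False by simp
      qed
    qed
    have "(\<lambda>k. integral\<^sup>L K (\<lambda>x. min 1 (real k * g x))) \<longlonglongrightarrow> integral\<^sup>L K (indicat_real {a<..})"
    proof (rule integral_dominated_convergence[where w = "\<lambda>_. 1"])
      show "AE x in K. norm (min 1 (real k * g x)) \<le> 1" for k
        by (rule AE_I2) (auto simp: g_def)
    qed (use lim in auto)
    then show ?thesis using K(2) sets_eq_imp_space_eq[OF K(2)] by (simp add: g_def)
  qed
  have bump: "periodic_continuous (\<lambda>x. min 1 (real k * max 0 (cos (2 * pi * (x - (1 + a) / 2)) - cos (pi * (1 - a)))))" for k a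
  proof -
    have "cos (2 * pi * (t + 1 - (1 + a) / 2)) = cos (2 * pi * (t - (1 + a) / 2))" for t
    proof -
      have "2 * pi * (t + 1 - (1 + a) / 2) = 2 * pi * (t - (1 + a) / 2) + 2 * pi" by (simp add: algebra_simps)
      then show ?thesis by (simp only: cos_periodic)
    qed
    then show ?thesis
      unfolding periodic_continuous_def by (auto intro!: continuous_intros)
  qed
  have total: "measure M UNIV = measure N UNIV"
    using eq[of "\<lambda>_. 1"] sets_eq_imp_space_eq[OF sets(1)] sets_eq_imp_space_eq[OF sets(2)]
    by (simp add: periodic_continuous_def)
  show ?thesis
  proof (rule measure_eqI_lessThan[OF sets])
    show "emeasure M {x<..} < \<infinity>" for x
      using M.emeasure_finite by (simp add: less_top[symmetric])
    fix x :: real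
    show "emeasure M {x<..} = emeasure N {x<..}"
    proof -
      consider "x < 0" | "0 \<le> x" "x < 1" | "1 \<le> x" by linarith
      then show ?thesis
      proof cases
        case 1
        have "emeasure K {x<..} = emeasure K UNIV" if "emeasure K (- {0..<1}) = 0" "sets K = sets borel" for K
          using that 1 by (intro emeasure_eq_AE AE_I[of _ _ "- {0..<1}"]) (auto simp: sets_eq_imp_space_eq)
        from this[OF supp(1) sets(1)] this[OF supp(2) sets(2)] show ?thesis
          using total by (simp add: M.emeasure_eq_measure N.emeasure_eq_measure)
      next
        case 2
        have "measure M {x<..} = measure N {x<..}"
          using arc[OF assms(1) sets(1) supp(1) 2] arc[OF assms(2) sets(2) supp(2) 2]
          unfolding eq[OF bump] by (rule LIMSEQ_unique)
        then show ?thesis by (simp add: M.emeasure_eq_measure N.emeasure_eq_measure)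
      next
        case 3
        then have "{x<..} \<subseteq> - {0..<1}" by auto
        then have "emeasure K {x<..} = 0" if "emeasure K (- {0..<1}) = 0" "sets K = sets borel" for K
          using emeasure_mono[of "{x<..}" "- {0..<1}" K] that by simp
        then show ?thesis using supp sets by simp
      qed
    qed
  qed
qed

section \<open>The transfer operator as conditional expectation\<close>

lemma frac_mult_frac: "frac (real k * frac x) = frac (real k * x)"
proof -
  have "real k * frac x = real k * x + of_int (- int k * \<lfloor>x\<rfloor>)"
    by (simp add: frac_def algebra_simps)
  then show ?thesis by (simp only: frac_add_of_int_right)
qed

lemma borel_measurable_frac [measurable]: "frac \<in> borel_measurable (borel :: real measure)"
  unfolding frac_def by measurable

lemma borel_measurable_riesz_factor [measurable]: "riesz_factor c \<in> borel_measurable borel"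
  using periodic_continuous_riesz_factor by (auto simp: periodic_continuous_def intro: borel_measurable_continuous_onI)

lemma borel_measurable_transfer [measurable (raw)]:
  assumes [measurable]: "h \<in> borel_measurable borel"
  shows "transfer q c h \<in> borel_measurable borel"
  unfolding transfer_def by measurable

lemma transfer_bounded:
  assumes "q \<ge> 2" "norm c \<le> 1" "\<And>x. \<bar>h x\<bar> \<le> B"
  shows "\<bar>transfer q c h y\<bar> \<le> B"
proof -
  have "\<bar>\<Sum>i<q. riesz_factor c ((y + real i) / q) * h ((y + real i) / q)\<bar>
      \<le> (\<Sum>i<q. riesz_factor c ((y + real i) / q) * B)"
    by (rule order.trans[OF sum_abs], intro sum_mono)
      (auto simp: abs_mult riesz_factor_bounds(1)[OF assms(2)] intro!: mult_mono assms(3))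
  also have "\<dots> = real q * B"
    by (simp only: sum_distrib_right[symmetric] sum_riesz_factor[OF assms(1)])
  finally show ?thesis using assms(1) by (simp add: transfer_def field_simps)
qed

lemma riesz_product_measurable:
  assumes "is_riesz_product l c \<mu>" "g \<in> borel_measurable borel"
  shows "g \<in> borel_measurable \<mu>"
proof -
  have "sets \<mu> = sets (restrict_space borel {0..<1})"
    using assms(1) by (simp add: is_riesz_product_def circle_lebesgue_def sets_restrict_space)
  then show ?thesis
    using measurable_restrict_space1[OF assms(2), of "{0..<1}"] measurable_cong_sets by blast
qed

text \<open>
  On the circle, functions such as \<open>h = f\<^sub>n\<close> may have a jump at the base point, and the defining limit of a Riesz product
  tests continuous functions only. The right-hand side is the integral of \<open>h\<close> with respect to a measure: the image
  of a density on the product with \<open>{..<q}\<close>, whose second coordinate selects the branch. This measure and the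
  distribution of \<open>frac (l m * x)\<close> agree on continuous periodic functions, hence they are equal.
\<close>

lemma integral_riesz_product_transfer_bounded:
  fixes l q :: "nat \<Rightarrow> nat"
  assumes l: "l 0 > 0" "\<And>n. l (Suc n) = q n * l n" and q: "\<And>n. q n \<ge> 2"
    and c: "\<And>n. norm (c n) \<le> 1" and \<mu>: "is_riesz_product l c \<mu>"
    and h[measurable]: "h \<in> borel_measurable borel" and h_bd: "\<And>x. \<bar>h x\<bar> \<le> B"
  shows "(LINT x|\<mu>. h (frac (l m * x))) = (LINT x|\<mu>. transfer (q m) (c m) h (frac (l (Suc m) * x)))"
proof -
  interpret prob_space \<mu> using \<mu> by (simp add: is_riesz_product_def)
  define T where "T x = frac (real (l m) * x)" for x
  define T' where "T' x = frac (real (l (Suc m)) * x)" for x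
  have T_range: "0 \<le> T x" "T x < 1" "0 \<le> T' x" "T' x < 1" for x
    by (auto simp: T_def T'_def frac_lt_1)
  have Tm[measurable]: "T \<in> borel_measurable \<mu>" "T' \<in> borel_measurable \<mu>"
    unfolding T_def T'_def by (rule riesz_product_measurable[OF \<mu>], measurable)+
  define Q where "Q = q m"
  have Q: "Q \<ge> 2" using q by (simp add: Q_def)
  \<comment> \<open>A point of the product space is a point \<open>x\<close> together with the number \<open>i\<close> of a preimage of \<open>T' x\<close>.\<close>
  define B2 where "B2 = \<mu> \<Otimes>\<^sub>M count_space {..<Q}"
  interpret C: finite_measure "count_space {..<Q}" by (rule finite_measure_count_space) simp
  interpret P: pair_sigma_finite \<mu> "count_space {..<Q}" ..
  interpret B2: finite_measure B2
    unfolding B2_def by (rule finite_measure_pair_measure) unfold_locales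
  define u where "u = (\<lambda>(x, i). (T' x + real i) / real Q)"
  define w where "w = (\<lambda>p. riesz_factor (c m) (u p) / real Q)"
  have [measurable]: "(\<lambda>p. real (snd p)) \<in> borel_measurable B2"
    unfolding B2_def by (rule measurable_compose[OF measurable_snd]) simp
  have [measurable]: "(\<lambda>p. T' (fst p)) \<in> borel_measurable B2"
    unfolding B2_def by (rule measurable_compose[OF measurable_fst]) (rule Tm)
  have um[measurable]: "u \<in> borel_measurable B2"
    unfolding u_def split_beta by measurable
  have wm[measurable]: "w \<in> borel_measurable B2"
    unfolding w_def by measurable
  have w_bd: "0 \<le> w p" "w p \<le> 2" for p
    using riesz_factor_bounds[OF c[of m], of "u p"] Q by (auto simp: w_def field_simps)
  define K where "K = distr (density B2 w) borel u"
  have K_int: "integral\<^sup>L K g = (LINT x|\<mu>. transfer Q (c m) g (T' x))"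
    if [measurable]: "g \<in> borel_measurable borel" and g: "\<And>x. \<bar>g x\<bar> \<le> G" for g G
  proof -
    have G0: "0 \<le> G" using g[of 0] by linarith
    have "integral\<^sup>L K g = (LINT p|density B2 w. g (u p))"
      unfolding K_def by (rule integral_distr) auto
    also have "\<dots> = (LINT p|B2. w p * g (u p))"
      using w_bd by (intro integral_real_density) auto
    also have "\<dots> = (LINT x|\<mu>. LINT i|count_space {..<Q}. w (x, i) * g (u (x, i)))"
      unfolding B2_def
    proof (rule P.integral_fst'[symmetric])
      show "integrable (\<mu> \<Otimes>\<^sub>M count_space {..<Q}) (\<lambda>p. w p * g (u p))"
        unfolding B2_def[symmetric]
      proof (rule B2.integrable_const_bound[of _ "2 * G"], rule AE_I2)
        show "norm (w p * g (u p)) \<le> 2 * G" for p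
          unfolding real_norm_def abs_mult using w_bd g G0 by (intro mult_mono) auto
      qed measurable
    qed
    also have "\<dots> = (LINT x|\<mu>. transfer Q (c m) g (T' x))"
      by (simp add: lebesgue_integral_count_space_finite transfer_def w_def u_def sum_divide_distrib)
    finally show ?thesis .
  qed
  have dist_eq: "distr \<mu> borel T = K"
  proof (rule circle_measure_eqI)
    show "finite_measure (distr \<mu> borel T)" by (rule finite_measure_distr) simp
    have "finite_measure (density B2 w)"
    proof
      have "emeasure (density B2 w) (space (density B2 w)) = (\<integral>\<^sup>+p. ennreal (w p) \<partial>B2)"
        by (subst emeasure_density) (auto intro!: nn_integral_cong)
      also have "\<dots> \<le> (\<integral>\<^sup>+p. 2 \<partial>B2)"
        using w_bd(2) by (intro nn_integral_mono) (metis ennreal_leI ennreal_numeral zero_le_numeral)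
      also have "\<dots> < \<infinity>" by (simp add: less_top[symmetric] ennreal_mult_eq_top_iff B2.emeasure_finite)
      finally show "emeasure (density B2 w) (space (density B2 w)) \<noteq> \<infinity>" by simp
    qed
    then show "finite_measure K"
      unfolding K_def by (rule finite_measure.finite_measure_distr) simp
    show "sets (distr \<mu> borel T) = sets borel" "sets K = sets borel" by (simp_all add: K_def)
    have "T -` (- {0..<1}) \<inter> space \<mu> = {}" using T_range by auto
    then show "emeasure (distr \<mu> borel T) (- {0..<1}) = 0" by (subst emeasure_distr) auto
    have "u p \<in> {0..<1}" if "p \<in> space B2" for p
    proof -
      have "snd p < Q" using that by (auto simp: B2_def space_pair_measure)
      then have "real (snd p) + 1 \<le> real Q" by linarith
      then have "T' (fst p) + real (snd p) < real Q" using T_range(4)[of "fst p"] by linarith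
      then show ?thesis using T_range(3)[of "fst p"] Q by (simp add: u_def split_beta)
    qed
    then have "u -` (- {0..<1}) \<inter> space (density B2 w) = {}" by auto
    then show "emeasure K (- {0..<1}) = 0" unfolding K_def by (subst emeasure_distr) auto
    fix g assume g: "periodic_continuous g"
    then have cont: "continuous_on UNIV g" by (simp add: periodic_continuous_def)
    then have gm: "g \<in> borel_measurable borel" by (rule borel_measurable_continuous_onI)
    have "bounded (g ` {0..1})"
      using compact_continuous_image[OF continuous_on_subset[OF cont]] by (intro compact_imp_bounded) auto
    then obtain G where G: "\<bar>g x\<bar> \<le> G" if "x \<in> {0..1}" for x
      unfolding bounded_iff by (metis imageI real_norm_def)
    have g_bd: "\<bar>g x\<bar> \<le> G" for x
      using G[of "frac x"] periodic_continuous_frac[OF g, of x] by (simp add: less_imp_le frac_lt_1)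
    have "integral\<^sup>L (distr \<mu> borel T) g = (LINT x|\<mu>. g (T x))"
      by (rule integral_distr) (auto intro: gm)
    also have "\<dots> = (LINT x|\<mu>. g (l m * x))"
      by (simp add: T_def periodic_continuous_frac[OF g])
    also have "\<dots> = (LINT x|\<mu>. transfer (q m) (c m) g (l (Suc m) * x))"
      by (rule integral_riesz_product_transfer[OF l q c \<mu> g])
    also have "\<dots> = (LINT x|\<mu>. transfer Q (c m) g (T' x))"
      using periodic_continuous_frac[OF periodic_continuous_transfer[OF g, of Q]] Q by (simp add: T'_def Q_def)
    also have "\<dots> = integral\<^sup>L K g" by (rule K_int[OF gm g_bd, symmetric])
    finally show "integral\<^sup>L (distr \<mu> borel T) g = integral\<^sup>L K g" .
  qed
  have "(LINT x|\<mu>. h (T x)) = integral\<^sup>L (distr \<mu> borel T) h"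
    by (rule integral_distr[symmetric]) auto
  also have "\<dots> = (LINT x|\<mu>. transfer Q (c m) h (T' x))"
    unfolding dist_eq by (rule K_int[OF h h_bd])
  finally show ?thesis by (simp add: T_def T'_def Q_def)
qed

lemma borel_measurable_transfer_iterate:
  "h \<in> borel_measurable borel \<Longrightarrow> transfer_iterate q c m j h \<in> borel_measurable borel"
  by (induction j) (auto intro: borel_measurable_transfer)

lemma transfer_iterate_bounded:
  assumes "\<And>n. q n \<ge> 2" "\<And>n. norm (c n) \<le> 1" "\<And>x. \<bar>h x\<bar> \<le> B"
  shows "\<bar>transfer_iterate q c m j h y\<bar> \<le> B"
  by (induction j arbitrary: y) (auto intro: transfer_bounded assms)

text \<open>
  The \<open>\<sigma>\<close>-algebras decrease because \<open>frac (l (Suc n) * x)\<close> is the function \<open>u \<mapsto> frac (q n * u)\<close> of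
  \<open>frac (l n * x)\<close>.
\<close>

lemma reverse_filtration_riesz_product:
  fixes l q :: "nat \<Rightarrow> nat"
  assumes l: "\<And>n. l (Suc n) = q n * l n" and \<mu>: "is_riesz_product l c \<mu>"
  shows "reverse_filtration \<mu> (\<lambda>n. vimage_algebra (space \<mu>) (\<lambda>x. frac (l n * x)) borel)"
proof -
  interpret prob_space \<mu> using \<mu> by (simp add: is_riesz_product_def)
  have T: "(\<lambda>x. frac (real (l n) * x)) \<in> borel_measurable \<mu>" for n
    by (rule riesz_product_measurable[OF \<mu>]) measurable
  show ?thesis
  proof
    fix n
    show "subalgebra \<mu> (vimage_algebra (space \<mu>) (\<lambda>x. frac (l n * x)) borel)"
      using measurable_sets[OF T[of n]] by (auto simp: subalgebra_def sets_vimage_algebra2)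
    show "sets (vimage_algebra (space \<mu>) (\<lambda>x. frac (l (Suc n) * x)) borel)
        \<subseteq> sets (vimage_algebra (space \<mu>) (\<lambda>x. frac (l n * x)) borel)"
    proof
      fix A assume "A \<in> sets (vimage_algebra (space \<mu>) (\<lambda>x. frac (l (Suc n) * x)) borel)"
      then obtain B where B: "B \<in> sets borel" "A = (\<lambda>x. frac (l (Suc n) * x)) -` B \<inter> space \<mu>"
        by (auto simp: sets_vimage_algebra2)
      have "frac (l (Suc n) * x) = frac (q n * frac (l n * x))" for x :: real
        by (simp add: frac_mult_frac l mult_ac)
      then have "A = (\<lambda>x. frac (l n * x)) -` ((\<lambda>u. frac (q n * u)) -` B) \<inter> space \<mu>"
        using B(2) by auto
      moreover have "(\<lambda>u. frac (real (q n) * u)) -` B \<in> sets borel"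
        using measurable_sets_borel[of "\<lambda>u. frac (real (q n) * u)" borel B] B(1) by simp
      ultimately show "A \<in> sets (vimage_algebra (space \<mu>) (\<lambda>x. frac (l n * x)) borel)"
        by (auto simp: sets_vimage_algebra2)
    qed
  qed
qed

text \<open>
  The transferred function is a version of the conditional expectation. The indicator of \<open>A\<close> is a function of
  \<open>frac (q n * u)\<close> and takes the same value at all branches of a point, so it can be pulled out of
  the operator.
\<close>

lemma transfer_tower:
  fixes l q :: "nat \<Rightarrow> nat"
  assumes l: "l 0 > 0" "\<And>n. l (Suc n) = q n * l n" and q: "\<And>n. q n \<ge> 2"
    and c: "\<And>n. norm (c n) \<le> 1" and \<mu>: "is_riesz_product l c \<mu>"
    and h[measurable]: "h \<in> borel_measurable borel" and h_bd: "\<And>x. \<bar>h x\<bar> \<le> B"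
    and A: "A \<in> sets (vimage_algebra (space \<mu>) (\<lambda>x. frac (l (Suc n) * x)) borel)"
  shows "(LINT x:A|\<mu>. h (frac (l n * x))) = (LINT x:A|\<mu>. transfer (q n) (c n) h (frac (l (Suc n) * x)))"
proof -
  obtain S where S[measurable]: "S \<in> sets borel" and A_eq: "A = (\<lambda>x. frac (l (Suc n) * x)) -` S \<inter> space \<mu>"
    using A by (auto simp: sets_vimage_algebra2)
  define g where "g u = indicat_real S (frac (q n * u)) * h u" for u :: real
  have [measurable]: "g \<in> borel_measurable borel" unfolding g_def by measurable
  have g_bd: "\<bar>g x\<bar> \<le> B" for x
    using h_bd[of x] by (auto simp: g_def indicator_def)
  have "frac (l (Suc n) * x) = frac (q n * frac (l n * x))" for x :: real
    by (simp add: frac_mult_frac l mult_ac)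
  then have 1: "indicat_real A x * h (frac (l n * x)) = g (frac (l n * x))" if "x \<in> space \<mu>" for x :: real
    using that by (simp add: g_def A_eq indicator_def)
  have 2: "indicat_real A x * transfer (q n) (c n) h (frac (l (Suc n) * x)) = transfer (q n) (c n) g (frac (l (Suc n) * x))"
    if "x \<in> space \<mu>" for x :: real
  proof -
    define v where "v = frac (real (l (Suc n)) * x)"
    have "frac (q n * ((v + real i) / q n)) = v" for i
    proof -
      have "q n * ((v + real i) / q n) = v + of_int (int i)" using q[of n] by simp
      then show ?thesis by (simp only: frac_add_of_int_right) (simp add: v_def)
    qed
    then have "g ((v + real i) / q n) = indicat_real S v * h ((v + real i) / q n)" for i
      by (simp only: g_def)
    then have "transfer (q n) (c n) g v = indicat_real S v * transfer (q n) (c n) h v"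
      by (simp add: transfer_def sum_distrib_left mult_ac)
    then show ?thesis using that by (simp add: v_def A_eq indicator_def)
  qed
  have "(LINT x:A|\<mu>. h (frac (l n * x))) = (LINT x|\<mu>. g (frac (l n * x)))"
    unfolding set_lebesgue_integral_def by (intro Bochner_Integration.integral_cong refl) (simp only: real_scaleR_def 1)
  also have "\<dots> = (LINT x|\<mu>. transfer (q n) (c n) g (frac (l (Suc n) * x)))"
    by (rule integral_riesz_product_transfer_bounded[OF l q c \<mu> _ g_bd]) measurable
  also have "\<dots> = (LINT x:A|\<mu>. transfer (q n) (c n) h (frac (l (Suc n) * x)))"
    unfolding set_lebesgue_integral_def by (intro Bochner_Integration.integral_cong refl) (simp only: real_scaleR_def 2)
  finally show ?thesis .
qed

section \<open>Almost everywhere convergence\<close>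

lemma modulus_of_continuityD:
  assumes "(SUP n. modulus_of_continuity S t (f n)) \<le> ereal w" "x \<in> S" "y \<in> S" "dist x y \<le> t"
  shows "dist (f n x) (f n y) \<le> w"
proof -
  have "ereal (dist (f n x) (f n y)) \<le> modulus_of_continuity S t (f n)"
    unfolding modulus_of_continuity_def using assms(2-4)
    by (intro SUP_upper2[of "(x, y)"]) auto
  also have "\<dots> \<le> (SUP n. modulus_of_continuity S t (f n))" by (rule SUP_upper) simp
  also have "\<dots> \<le> ereal w" by (rule assms(1))
  finally show ?thesis by simp
qed

text \<open>
  The scale \<open>\<eta> = (23/25)^(j+1)\<close> balances the two error terms: the contraction reduces the Lipschitz
  constant \<open>w / \<eta>\<close> to \<open>25/23 w\<close>, the same order as the additive error \<open>39 w\<close>.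
\<close>

lemma transfer_iterate_log_modulus:
  fixes h :: "real \<Rightarrow> real"
  assumes q: "\<And>n. q n \<ge> 3" and c: "\<And>n. norm (c n) \<le> 1" and C: "C > 0"
    and h: "\<And>t x y. 0 < t \<Longrightarrow> t < 1 \<Longrightarrow> x \<in> {0..1} \<Longrightarrow> y \<in> {0..1} \<Longrightarrow> \<bar>x - y\<bar> \<le> t \<Longrightarrow>
      \<bar>h x - h y\<bar> \<le> C / \<bar>ln t\<bar> powr s"
    and x: "x \<in> {0..<1}" and y: "y \<in> {0..<1}"
  shows "\<bar>transfer_iterate q c m j h x - transfer_iterate q c m j h y\<bar>
    \<le> 41 * C / ln (25/23) powr s / real (Suc j) powr s"
proof -
  define \<eta> :: real where "\<eta> = (23/25) ^ Suc j"
  define w where "w = C / \<bar>ln \<eta>\<bar> powr s"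
  have \<eta>: "0 < \<eta>" "\<eta> < 1" unfolding \<eta>_def by (simp, intro power_Suc_less_one) auto
  have w0: "0 \<le> w" using C by (simp add: w_def)
  have "ln \<eta> = - (real (Suc j) * ln (25/23))"
    unfolding \<eta>_def by (subst ln_realpow) (auto simp: ln_div algebra_simps)
  then have ln_\<eta>: "\<bar>ln \<eta>\<bar> = ln (25/23) * real (Suc j)" by (simp add: mult.commute)
  have coarse: "\<bar>h u - h v\<bar> \<le> w / \<eta> * \<bar>u - v\<bar> + w" if "u \<in> {0..<1}" "v \<in> {0..<1}" for u v
    by (rule coarse_Lipschitz[where \<eta> = \<eta>]) (use h[OF \<eta>] \<eta> w0 that in \<open>auto simp: w_def\<close>)
  have "\<bar>transfer_iterate q c m j h x - transfer_iterate q c m j h y\<bar> \<le> (23/25) ^ j * (w / \<eta>) + 39 * w"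
    by (rule transfer_iterate_oscillation[OF q c coarse _ w0 x y]) (use \<eta> w0 in auto)
  also have "(23/25) ^ j * (w / \<eta>) = 25/23 * w" by (simp add: \<eta>_def)
  also have "25/23 * w + 39 * w \<le> 41 * w" using w0 by simp
  also have "w = C / (ln (25/23) powr s * real (Suc j) powr s)"
    unfolding w_def ln_\<eta> by (subst powr_mult) auto
  finally show ?thesis by simp
qed

text \<open>
  The functions \<open>h n\<close> matter on \<open>[0,1]\<close> only. Composing them with the projection onto \<open>[0,1]\<close> makes them
  continuous and bounded on the whole line, hence Borel, without changing the series.
\<close>

lemma AE_summable_riesz_product_real:
  fixes l q :: "nat \<Rightarrow> nat" and h :: "nat \<Rightarrow> real \<Rightarrow> real" and a :: "nat \<Rightarrow> real"
  assumes l: "l 0 > 0" "\<And>n. l (Suc n) = q n * l n" and q: "\<And>n. q n \<ge> 3"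
    and c: "\<And>n. norm (c n) \<le> 1" and \<mu>: "is_riesz_product l c \<mu>" and C: "C > 0" and \<epsilon>: "\<epsilon> > 0"
    and h: "\<And>n t x y. 0 < t \<Longrightarrow> t < 1 \<Longrightarrow> x \<in> {0..1} \<Longrightarrow> y \<in> {0..1} \<Longrightarrow> \<bar>x - y\<bar> \<le> t \<Longrightarrow>
      \<bar>h n x - h n y\<bar> \<le> C / \<bar>ln t\<bar> powr (1/2 + \<epsilon>)"
    and a: "summable (\<lambda>n. (a n)\<^sup>2)"
  shows "AE x in \<mu>. summable (\<lambda>n. a n * (h n (frac (l n * x)) - (LINT y|\<mu>. h n (frac (l n * y)))))"
    and "integrable \<mu> (\<lambda>x. h n (frac (l n * x)))"
proof -
  have q2: "q n \<ge> 2" for n using q[of n] by simp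
  define s where "s = 1/2 + \<epsilon>"
  have s: "s > 0" using \<epsilon> by (simp add: s_def)
  define g where "g n u = h n (max 0 (min 1 u))" for n u
  have g_eq: "g n u = h n u" if "u \<in> {0..1}" for n u using that by (simp add: g_def)
  have frac_I: "frac t \<in> {0..<1}" "frac t \<in> {0..1}" for t :: real
    by (auto simp: frac_lt_1 less_imp_le)
  have g_mod: "\<bar>g n x - g n y\<bar> \<le> C / \<bar>ln t\<bar> powr s" if "0 < t" "t < 1" "\<bar>x - y\<bar> \<le> t" for n t x y
    unfolding g_def s_def using that by (intro h) (auto simp: max_def min_def abs_if split: if_splits)
  have g_cont: "continuous_on UNIV (g n)" for n
    unfolding continuous_on_iff
  proof (intro ballI allI impI)
    fix x e :: real assume e: "0 < e"
    \<comment> \<open>The scale at which the logarithmic modulus equals \<open>e / 2\<close>.\<close>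
    define t where "t = exp (- ((2 * C / e) powr (1 / s)))"
    have t: "0 < t" "t < 1" using C e by (auto simp: t_def)
    have "\<bar>ln t\<bar> powr s = 2 * C / e"
      using C e s by (simp add: t_def powr_powr)
    then have small: "C / \<bar>ln t\<bar> powr s < e" using C e by simp
    show "\<exists>d>0. \<forall>x'\<in>UNIV. dist x' x < d \<longrightarrow> dist (g n x') (g n x) < e"
    proof (intro exI[of _ t] conjI ballI impI t)
      fix x' assume "dist x' x < t"
      then show "dist (g n x') (g n x) < e"
        using g_mod[OF t, of x' x n] small by (simp add: dist_real_def)
    qed
  qed
  have g_meas: "g n \<in> borel_measurable borel" for n
    using g_cont by (rule borel_measurable_continuous_onI)
  have "\<exists>B. \<forall>u. \<bar>g n u\<bar> \<le> B" for n
  proof -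
    have "bounded (g n ` {0..1})"
      using compact_continuous_image[OF continuous_on_subset[OF g_cont]] by (intro compact_imp_bounded) auto
    then obtain B where "\<And>u. u \<in> {0..1} \<Longrightarrow> \<bar>g n u\<bar> \<le> B"
      unfolding bounded_iff by (metis imageI real_norm_def)
    then have "\<bar>g n (max 0 (min 1 u))\<bar> \<le> B" for u by simp
    then show ?thesis by (auto simp: g_def)
  qed
  then obtain B where g_bd: "\<bar>g n u\<bar> \<le> B n" for n u by metis
  define T where "T n x = frac (real (l n) * x)" for n x
  define F where "F n = vimage_algebra (space \<mu>) (T n) borel" for n
  interpret reverse_filtration \<mu> F
    unfolding F_def T_def by (rule reverse_filtration_riesz_product[OF l(2) \<mu>])
  define H where "H m j = transfer_iterate q c m j (g m)" for m j
  have H_meas: "H m j \<in> borel_measurable borel" for m j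
    unfolding H_def by (rule borel_measurable_transfer_iterate[OF g_meas])
  have H_bd: "\<bar>H m j u\<bar> \<le> B m" for m j u
    unfolding H_def by (rule transfer_iterate_bounded[OF q2 c g_bd])
  have HT_F: "(\<lambda>x. H m j (T n x)) \<in> borel_measurable (F n)" for m j n
    unfolding F_def by (rule measurable_compose[OF measurable_vimage_algebra1 H_meas]) auto
  have HT_int: "integrable \<mu> (\<lambda>x. H m j (T n x))" for m j n
    using measurable_F_imp_M[OF HT_F] H_bd by (rule integrable_bounded)
  define E where "E m = (LINT x|\<mu>. H m 0 (T m x))" for m
  have E: "(LINT x|\<mu>. H m j (T (m + j) x)) = E m" for m j
  proof (induction j)
    case (Suc j)
    have "(LINT x|\<mu>. H m j (T (m + j) x)) = (LINT x|\<mu>. H m (Suc j) (T (Suc (m + j)) x))"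
      unfolding T_def H_def transfer_iterate.simps
      by (rule integral_riesz_product_transfer_bounded[OF l q2 c \<mu> H_meas[unfolded H_def] H_bd[unfolded H_def]])
    then show ?case using Suc by simp
  qed (simp add: E_def)
  define Y where "Y m j x = H m j (T (m + j) x) - E m" for m j x
  define K where "K = 41 * C / ln (25/23) powr s"
  have "AE x in \<mu>. summable (\<lambda>m. a m * Y m 0 x)"
  proof (rule AE_summable_reverse_martingale[OF _ _ _ \<epsilon> a])
    show "Y m j \<in> borel_measurable (F (m + j))" for m j
      unfolding Y_def using HT_F[of m j "m + j"] by measurable
    show "\<bar>Y m j x\<bar> \<le> K / real (Suc j) powr (1/2 + \<epsilon>)" for m j x
    proof -
      have osc: "\<bar>H m j (T (m + j) x) - H m j (T (m + j) x')\<bar> \<le> K / real (Suc j) powr s" for x'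
        unfolding H_def K_def T_def
        by (rule transfer_iterate_log_modulus[OF q c C]) (use g_mod frac_I in auto)
      have "E m \<le> H m j (T (m + j) x) + K / real (Suc j) powr s"
        unfolding E[of m j, symmetric]
      proof (intro integral_le_const HT_int AE_I2)
        show "H m j (T (m + j) x') \<le> H m j (T (m + j) x) + K / real (Suc j) powr s" for x'
          using osc[of x'] by linarith
      qed
      moreover have "E m \<ge> H m j (T (m + j) x) - K / real (Suc j) powr s"
        unfolding E[of m j, symmetric]
      proof (intro integral_ge_const HT_int AE_I2)
        show "H m j (T (m + j) x) - K / real (Suc j) powr s \<le> H m j (T (m + j) x')" for x'
          using osc[of x'] by linarith
      qed
      ultimately show ?thesis unfolding Y_def s_def by linarith
    qed
    show "(LINT x:A|\<mu>. Y m j x) = (LINT x:A|\<mu>. Y m (Suc j) x)" if A: "A \<in> sets (F (Suc (m + j)))" for m j A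
    proof -
      have AM: "A \<in> sets \<mu>" using A subalgebra_F by (auto simp: subalgebra_def)
      have si: "set_integrable \<mu> A (\<lambda>x. H m j (T n x))" "set_integrable \<mu> A (\<lambda>_. E m)" for j n
        unfolding set_integrable_def
        by (intro integrable_mult_indicator AM HT_int, intro integrable_mult_indicator AM integrable_const)
      have "(LINT x:A|\<mu>. H m j (T (m + j) x)) = (LINT x:A|\<mu>. H m (Suc j) (T (Suc (m + j)) x))"
        unfolding T_def H_def transfer_iterate.simps
        by (rule transfer_tower[OF l q2 c \<mu> H_meas[unfolded H_def] H_bd[unfolded H_def]])
          (rule A[unfolded F_def T_def])
      then show ?thesis unfolding Y_def using si by (simp add: set_integral_diff)
    qed
  qed
  moreover have "H m 0 (T m x) = h m (frac (l m * x))" for m and x :: real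
    using frac_I by (simp add: H_def T_def g_eq)
  ultimately show "AE x in \<mu>. summable (\<lambda>n. a n * (h n (frac (l n * x)) - (LINT y|\<mu>. h n (frac (l n * y)))))"
    by (simp add: Y_def E_def)
  show "integrable \<mu> (\<lambda>x. h n (frac (l n * x)))"
    using HT_int[of n 0 n] frac_I by (simp add: H_def T_def g_eq)
qed

theorem theorem24:
  fixes l :: "nat \<Rightarrow> nat" and c :: "nat \<Rightarrow> complex" and \<mu> :: "real measure"
    and f :: "nat \<Rightarrow> real \<Rightarrow> complex" and a :: "nat \<Rightarrow> complex"
  assumes l_pos: "\<And>n. l n > 0"
    and l_lacunary: "\<And>n. l (Suc n) \<ge> 3 * l n"
    and l_dvd: "\<And>n. l n dvd l (Suc n)"
    and c_bound: "(SUP n. ereal (norm (c n))) < 1"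
    and riesz: "is_riesz_product l c \<mu>"
    and f_modulus: "\<exists>C>0. \<exists>\<epsilon>>0. \<forall>t. 0 < t \<and> t < 1 \<longrightarrow>
        (SUP n. modulus_of_continuity {0..1} t (f n)) \<le> ereal (C / \<bar>ln t\<bar> powr (1/2 + \<epsilon>))"
    and a_l2: "summable (\<lambda>n. (norm (a n))\<^sup>2)"
  shows "AE x in \<mu>. summable (\<lambda>n. a n *
           (f n (frac (real (l n) * x)) - (LINT y|\<mu>. f n (frac (real (l n) * y)))))"
proof -
  define q where "q n = l (Suc n) div l n" for n
  have l_Suc: "l (Suc n) = q n * l n" for n using l_dvd by (simp add: q_def)
  have q: "q n \<ge> 3" for n
    using l_lacunary[of n] l_pos[of n] unfolding l_Suc by simp
  have c: "norm (c n) \<le> 1" for n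
  proof -
    have "ereal (norm (c n)) \<le> (SUP n. ereal (norm (c n)))" by (rule SUP_upper) simp
    also have "\<dots> \<le> ereal 1" using c_bound by (simp add: one_ereal_def)
    finally show ?thesis by simp
  qed
  obtain C \<epsilon> where C: "C > 0" and \<epsilon>: "\<epsilon> > 0"
    and mod: "\<And>t. 0 < t \<Longrightarrow> t < 1 \<Longrightarrow>
        (SUP n. modulus_of_continuity {0..1} t (f n)) \<le> ereal (C / \<bar>ln t\<bar> powr (1/2 + \<epsilon>))"
    using f_modulus by blast
  have f: "dist (f n x) (f n y) \<le> C / \<bar>ln t\<bar> powr (1/2 + \<epsilon>)"
    if "0 < t" "t < 1" "x \<in> {0..1}" "y \<in> {0..1}" "\<bar>x - y\<bar> \<le> t" for n t x y
    using modulus_of_continuityD[OF mod[OF that(1,2)] that(3,4)] that(5) by (simp add: dist_real_def)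
  have f_Re: "\<bar>Re (f n x) - Re (f n y)\<bar> \<le> C / \<bar>ln t\<bar> powr (1/2 + \<epsilon>)"
    if "0 < t" "t < 1" "x \<in> {0..1}" "y \<in> {0..1}" "\<bar>x - y\<bar> \<le> t" for n t x y
    using f[OF that, of n] abs_Re_le_cmod[of "f n x - f n y"] by (simp add: dist_norm)
  have f_Im: "\<bar>Im (f n x) - Im (f n y)\<bar> \<le> C / \<bar>ln t\<bar> powr (1/2 + \<epsilon>)"
    if "0 < t" "t < 1" "x \<in> {0..1}" "y \<in> {0..1}" "\<bar>x - y\<bar> \<le> t" for n t x y
    using f[OF that, of n] abs_Im_le_cmod[of "f n x - f n y"] by (simp add: dist_norm)
  have a_Re: "summable (\<lambda>n. (Re (a n))\<^sup>2)" and a_Im: "summable (\<lambda>n. (Im (a n))\<^sup>2)"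
    by (auto intro!: summable_comparison_test[OF _ a_l2] simp: cmod_power2)
  note re = AE_summable_riesz_product_real[where h = "\<lambda>n x. Re (f n x)", OF l_pos l_Suc q c riesz C \<epsilon>]
  note im = AE_summable_riesz_product_real[where h = "\<lambda>n x. Im (f n x)", OF l_pos l_Suc q c riesz C \<epsilon>]
  define S where "S n x = f n (frac (real (l n) * x)) - (LINT y|\<mu>. f n (frac (real (l n) * y)))" for n x
  have int: "integrable \<mu> (\<lambda>x. f n (frac (real (l n) * x)))" for n
  proof -
    have "integrable \<mu> (\<lambda>x. Re (f n (frac (real (l n) * x))))"
      by (rule re(2)[OF _ a_Re]) (fact f_Re)
    moreover have "integrable \<mu> (\<lambda>x. Im (f n (frac (real (l n) * x))))"
      by (rule im(2)[OF _ a_Re]) (fact f_Im)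
    ultimately have "integrable \<mu> (\<lambda>x. complex_of_real (Re (f n (frac (real (l n) * x)))) +
        \<i> * complex_of_real (Im (f n (frac (real (l n) * x)))))"
      by auto
    then show ?thesis by (simp only: complex_eq[symmetric])
  qed
  have S_Re: "Re (S n x) = Re (f n (frac (l n * x))) - (LINT y|\<mu>. Re (f n (frac (l n * y))))" for n and x :: real
    unfolding S_def using int[of n] by (simp add: integral_Re)
  have S_Im: "Im (S n x) = Im (f n (frac (l n * x))) - (LINT y|\<mu>. Im (f n (frac (l n * y))))" for n and x :: real
    unfolding S_def using int[of n] by (simp add: integral_Im)
  have re_S: "AE x in \<mu>. summable (\<lambda>n. b n * Re (S n x))" if "summable (\<lambda>n. (b n)\<^sup>2)" for b
    unfolding S_Re by (rule re(1)[OF _ that]) (fact f_Re)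
  have im_S: "AE x in \<mu>. summable (\<lambda>n. b n * Im (S n x))" if "summable (\<lambda>n. (b n)\<^sup>2)" for b
    unfolding S_Im by (rule im(1)[OF _ that]) (fact f_Im)
  from re_S[OF a_Re] re_S[OF a_Im] im_S[OF a_Re] im_S[OF a_Im]
  have "AE x in \<mu>. summable (\<lambda>n. a n * S n x)"
  proof eventually_elim
    case (elim x)
    then show ?case
      using summable_diff[OF elim(1,4)] summable_add[OF elim(3,2)]
      by (simp add: summable_complex_iff)
  qed
  then show ?thesis by (simp add: S_def)
qed

end
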